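(* For $n\ge1$ and $k\ge2$ let $$D_k=\frac{1}{n+1}\sum(i_1\,i_2)(i_2\,i_3)\cdots(i_{k-1}\,i_k)(i_k\,i_1)\in\mathbb{C}[S_n],$$ the sum over $(i_1,\dots,i_k)\in\{0,1,\dots,n\}^k$ with $i_j\neq i_{j+1}$ for $1\le j<k$ and $i_k\ne i_1$, where a transposition $(a\,b)$ with $a=0$ or $b=0$ is interpreted as the identity. Write $D_k=\sum_\lambda N_\lambda[D_k](n)\,\hat\Sigma_{\lambda,n}$. Then: (i) $N_\lambda[D_k](n)=0$ unless $\lambda=\mathrm{Rem}_k(\mu)$ for some $\mu\in\bar{\mathbb{Y}}_k$; (ii) for fixed $k$ and $\lambda=\mathrm{Rem}_k(\mu)$ with $\mu\in\bar{\mathbb{Y}}_k$, as $n\to\infty$, $$N_\lambda[D_k](n)=|\mathrm{NC}(\mu)|\,n^{\frac{l(\lambda)+k}{2}}\big(1+O(n^{-1})\big).$$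
   Context: $\bar{\mathbb{Y}}_k$ is the set of partitions of $k$ all of whose parts are $\ge2$. For a partition $\lambda$ with parts $\ge2$ (possibly empty), $|\lambda|$ is its size, $\ell(\lambda)$ its number of parts and $l(\lambda)=|\lambda|-\ell(\lambda)$. $\mathrm{Rem}_k:\bar{\mathbb{Y}}_k\to\{\text{partitions with parts}\ge2\}$ removes all parts equal to $2$ and then subtracts $1$ from each remaining part (removes the first column); it is injective. For $\lambda$ with parts $\ge2$ and $|\lambda|\le n$, $\Sigma_{\lambda,n}=\sum(a_{1,1}\cdots a_{1,\lambda_1})\cdots(a_{\ell,1}\cdots a_{\ell,\lambda_\ell})$ over all choices of pairwise distinct $a_{p,q}\in\{1,\dots,n\}$, and $\hat\Sigma_{\lambda,n}=\Sigma_{\lambda,n}/(n(n-1)\cdots(n-|\lambda|+1))$ ($\hat\Sigma_{\emptyset,n}=e$); these form a basis of the center of $\mathbb{C}[S_n]$, and $N_\lambda[x](n)$ denotes the coefficient of $\hat\Sigma_{\lambda,n}$ in a central element $x$ (equivalently, the sum of the coefficients of $x$ on permutations whose cycles of length $\ge2$ have lengths given by $\lambda$). For $\mu\in\bar{\mathbb{Y}}_k$, $\mathrm{NC}(\mu)$ is the set of non-crossing set partitions of $\{1,\dots,k\}$ whose multiset of block sizes is $\mu$. *)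

theory Defs
  imports Complex_Main "HOL-Combinatorics.Orbits" "HOL-Combinatorics.Transposition"
    "HOL-Library.Multiset" "HOL-Library.Disjoint_Sets" "HOL-Library.Landau_Symbols"
begin

text \<open>Elements of the group algebra C[S_n] are represented as coefficient functions
  on maps nat => nat; only permutations of {1..n} carry nonzero coefficients.
  Multiplication of permutations is function composition.\<close>

definition tr0 :: "nat \<Rightarrow> nat \<Rightarrow> nat \<Rightarrow> nat" where
  "tr0 a b = (if a = 0 \<or> b = 0 then id else transpose a b)"

definition adm_tuples :: "nat \<Rightarrow> nat \<Rightarrow> nat list set" where
  "adm_tuples n k = {is. length is = k \<and> set is \<subseteq> {0..n} \<and>
      (\<forall>j. j + 1 < k \<longrightarrow> is ! j \<noteq> is ! (j + 1)) \<and> is ! (k - 1) \<noteq> is ! 0}"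

definition tuple_prod :: "nat list \<Rightarrow> nat \<Rightarrow> nat" where
  "tuple_prod is = foldr (\<circ>) (map (\<lambda>(a, b). tr0 a b) (zip is (tl is @ [hd is]))) id"

definition Dk :: "nat \<Rightarrow> nat \<Rightarrow> (nat \<Rightarrow> nat) \<Rightarrow> complex" where
  "Dk n k \<sigma> = of_nat (card {is \<in> adm_tuples n k. tuple_prod is = \<sigma>}) / of_nat (n + 1)"

definition cyc_type :: "nat \<Rightarrow> (nat \<Rightarrow> nat) \<Rightarrow> nat multiset" where
  "cyc_type n \<sigma> = filter_mset (\<lambda>m. 2 \<le> m) (image_mset card (mset_set (orbit \<sigma> ` {1..n})))"

definition Ncoef :: "nat multiset \<Rightarrow> ((nat \<Rightarrow> nat) \<Rightarrow> complex) \<Rightarrow> nat \<Rightarrow> complex" where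
  "Ncoef lam x n = (\<Sum>\<sigma> \<in> {\<sigma>. \<sigma> permutes {1..n} \<and> cyc_type n \<sigma> = lam}. x \<sigma>)"

definition parts_ge2 :: "nat multiset \<Rightarrow> bool" where
  "parts_ge2 lam \<longleftrightarrow> (\<forall>x \<in># lam. 2 \<le> x)"

definition Ybar :: "nat \<Rightarrow> nat multiset set" where
  "Ybar k = {\<mu>. parts_ge2 \<mu> \<and> sum_mset \<mu> = k}"

definition Rem :: "nat multiset \<Rightarrow> nat multiset" where
  "Rem \<mu> = image_mset (\<lambda>x. x - 1) (filter_mset (\<lambda>x. x \<noteq> 2) \<mu>)"

definition lfun :: "nat multiset \<Rightarrow> nat" where
  "lfun lam = sum_mset lam - size lam"

definition noncrossing :: "nat set set \<Rightarrow> bool" where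
  "noncrossing P \<longleftrightarrow> (\<forall>B\<in>P. \<forall>B'\<in>P. B \<noteq> B' \<longrightarrow>
     \<not> (\<exists>a b c d. a < b \<and> b < c \<and> c < d \<and> a \<in> B \<and> c \<in> B \<and> b \<in> B' \<and> d \<in> B'))"

definition NC :: "nat multiset \<Rightarrow> nat set set set" where
  "NC \<mu> = {P. partition_on {1..sum_mset \<mu>} P \<and> noncrossing P \<and> image_mset card (mset_set P) = \<mu>}"

end

theory Submission
  imports Defs
begin

text \<open>
  A tuple is read as a closed walk, and its product is built up one transposition at a time.
  A step from a letter to a new letter inserts the latter into the cycle of the former; a step to
  an old letter of the same cycle splits that cycle; a step to an old letter of another cycle merges
  two cycles. Writing b for the number of nonzero letters visited and c for the number of cycles on
  them, b + c grows by one in the first two cases and drops by one in the third. So b + c is at most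
  k + 2 for a closed walk avoiding 0, with equality iff no merge ever occurs. As b - c depends only
  on the cycle type, this bounds b, hence the order of growth of the number of such tuples; walks
  through 0 lose the same amount.

  In the extremal walks the cycle of the current letter behaves as a stack: a step pushes a new letter
  or pops to a letter strictly below, splitting off a completed cycle. Recording pushes and
  pop lengths turns these walks into Lukasiewicz paths, a path with e pushes being realised by
  n (n - 1) ... (n - e) walks. Running the same stack on positions instead of letters and closing a
  block at each pop identifies the paths with noncrossing partitions: popping d letters corresponds
  to a block of size d + 1 and a cycle of length d, which is exactly the effect of Rem.
\<close>

section \<open>Orbits under multiplication by a transposition\<close>

lemma permutes_orbit_self:
  assumes "finite V" "p permutes V"
  shows "x \<in> orbit p x"
  using assms permutation_permutes permutation_self_in_orbit by metis

lemma orbit_eq_iff_mem: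
  assumes "finite V" "p permutes V"
  shows "orbit p x = orbit p y \<longleftrightarrow> x \<in> orbit p y"
proof -
  have "cyclic_on p (orbit p y)"
    using assms by (intro cyclic_on_orbit)
  then show ?thesis
    using permutes_orbit_self[OF assms] orbit_cyclic_eq3 by metis
qed

text \<open>The product sends b to \<open>p a\<close> and then follows the cycle of a undisturbed,
  as b is not on it, until it arrives at a.\<close>

lemma orbit_transpose_merge:
  assumes V: "finite V" "p permutes V" and ab: "a \<in> V" "b \<in> V" "b \<notin> orbit p a"
  shows "a \<in> orbit (p \<circ> transpose a b) b"
proof -
  have "y \<in> orbit (p \<circ> transpose a b) b" if "y \<in> orbit p a" for y
    using that
  proof induction
    case base
    have "(p \<circ> transpose a b) b = p a" by simp
    then show ?case by (metis orbit.base)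
  next
    case (step y)
    show ?case
    proof (cases "y = a")
      case True
      have "(p \<circ> transpose a b) b = p y" using True by simp
      then show ?thesis by (metis orbit.base)
    next
      case False
      have "y \<noteq> b" using step(1) ab(3) by blast
      then have "(p \<circ> transpose a b) y = p y" using False by (simp add: transpose_def)
      then show ?thesis using step(2) by (metis orbit.step)
    qed
  qed
  then show ?thesis using permutes_orbit_self[OF V] by blast
qed

text \<open>With m the first positive time at which p takes a to b, the product sends b to
  \<open>p a\<close>, runs along this arc up to b and closes there, before p would have returned to
  a.\<close>

lemma orbit_transpose_split:
  assumes V: "finite V" "p permutes V" and ab: "a \<noteq> b" "b \<in> orbit p a"
  shows "a \<notin> orbit (p \<circ> transpose a b) b"
proof -
  define m where "m = funpow_dist1 p a b"
  have m: "(p ^^ m) a = b" "0 < m"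
    unfolding m_def using funpow_dist1_prop[OF ab(2)] by auto
  have ne_b: "(p ^^ i) a \<noteq> b" if "0 < i" "i < m" for i
    using that funpow_dist1_least unfolding m_def by metis
  have ne_a: "(p ^^ i) a \<noteq> a" if "0 < i" "i \<le> m" for i
  proof
    assume eq: "(p ^^ i) a = a"
    have "i \<noteq> m" using eq m(1) ab(1) by auto
    then have "i < m" using that by simp
    have "(p ^^ (m - i)) ((p ^^ i) a) = b"
      using m(1) \<open>i < m\<close> funpow_add[of "m - i" i p] by simp
    then show False using eq ne_b[of "m - i"] \<open>i < m\<close> that by simp
  qed
  have "\<exists>i. 0 < i \<and> i \<le> m \<and> y = (p ^^ i) a" if "y \<in> orbit (p \<circ> transpose a b) b" for y
    using that
  proof induction
    case base
    show ?case by (rule exI[of _ 1]) (use m in auto)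
  next
    case (step y)
    then obtain i where i: "0 < i" "i \<le> m" "y = (p ^^ i) a" by blast
    show ?case
    proof (cases "i = m")
      case True
      show ?thesis by (rule exI[of _ 1]) (use m i True in auto)
    next
      case False
      then have "y \<noteq> a" "y \<noteq> b" using ne_a ne_b i by auto
      then show ?thesis using False i by (intro exI[of _ "Suc i"]) auto
    qed
  qed
  then show ?thesis using ne_a by metis
qed

text \<open>Cycles avoiding both a and b are common to the two maps, so the counts differ only in
  whether a and b share one cycle or lie on two.\<close>

lemma card_orbits_transpose:
  assumes V: "finite V" "p permutes V" and ab: "a \<in> V" "b \<in> V" "a \<noteq> b"
  shows "b \<notin> orbit p a \<Longrightarrow> card (orbit p ` V) = Suc (card (orbit (p \<circ> transpose a b) ` V))"
    and "b \<in> orbit p a \<Longrightarrow> card (orbit (p \<circ> transpose a b) ` V) = Suc (card (orbit p ` V))"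
proof -
  define q where "q = p \<circ> transpose a b"
  have q: "q permutes V"
    unfolding q_def using V ab by (intro permutes_compose permutes_swap_id)
  \<comment> \<open>A transposition is its own inverse, so p and q have symmetric roles and one
    inclusion serves for both directions.\<close>
  have pq: "p = q \<circ> transpose a b"
    by (simp add: q_def comp_assoc)
  define Out where "Out r = {C \<in> orbit r ` V. a \<notin> C \<and> b \<notin> C}" for r
  have sub: "Out r \<subseteq> Out s" if "r permutes V" "s = r \<circ> transpose a b" for r s
  proof
    fix C assume "C \<in> Out r"
    then obtain x where x: "x \<in> V" "C = orbit r x" "a \<notin> C" "b \<notin> C" by (auto simp: Out_def)
    have "orbit s x = orbit r x"
    proof (rule orbit_cong)
      show "x \<in> orbit r x" using permutes_orbit_self[OF V(1) that(1)] .
      show "s y = r y" if "y \<in> orbit r x" for y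
        using that x \<open>s = _\<close> by (auto simp: transpose_def)
    qed
    then show "C \<in> Out s" using x by (auto simp: Out_def)
  qed
  have Out: "Out p = Out q"
    using sub[OF V(2) q_def] sub[OF q pq] by blast
  have split: "orbit r ` V = Out r \<union> {orbit r a, orbit r b}" if "r permutes V" for r
  proof -
    have "C = orbit r a \<or> C = orbit r b" if "C \<in> orbit r ` V" "C \<notin> Out r" for C
      using that orbit_eq_iff_mem[OF V(1) \<open>r permutes V\<close>] by (auto simp: Out_def)
    then show ?thesis using ab by (auto simp: Out_def)
  qed
  have fin: "finite (Out r)" for r using V by (auto simp: Out_def)
  have disj: "orbit r a \<notin> Out r" "orbit r b \<notin> Out r" if "r permutes V" for r
    using permutes_orbit_self[OF V(1) that] by (auto simp: Out_def)
  have count: "card (orbit r ` V) = card (Out r) + (if b \<in> orbit r a then 1 else 2)" if "r permutes V" for r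
  proof -
    have "card {orbit r a, orbit r b} = (if b \<in> orbit r a then 1 else 2)"
      using orbit_eq_iff_mem[OF V(1) that, of b a] by (auto simp: card_insert_if)
    then show ?thesis
      unfolding split[OF that] using fin[of r] disj[OF that]
      by (subst card_Un_disjoint) auto
  qed
  have sym: "b \<in> orbit q a \<longleftrightarrow> a \<in> orbit q b"
    using orbit_eq_iff_mem[OF V(1) q] by metis
  show "b \<notin> orbit p a \<Longrightarrow> card (orbit p ` V) = Suc (card (orbit (p \<circ> transpose a b) ` V))"
    using orbit_transpose_merge[OF V ab(1,2)] count[OF V(2)] count[OF q] Out sym
    unfolding q_def by simp
  show "b \<in> orbit p a \<Longrightarrow> card (orbit (p \<circ> transpose a b) ` V) = Suc (card (orbit p ` V))"
    using orbit_transpose_split[OF V ab(3)] count[OF V(2)] count[OF q] Out sym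
    unfolding q_def by simp
qed

lemma card_orbits_insert_fixed:
  assumes V: "finite V" "p permutes V" and y: "y \<notin> V"
  shows "card (orbit p ` insert y V) = Suc (card (orbit p ` V))"
proof -
  have "orbit p y = {y}"
    using permutes_not_in[OF V(2) y] by (simp add: orbit_eq_singleton_iff)
  moreover have "orbit p x \<noteq> {y}" if "x \<in> V" for x
    using permutes_orbit_self[OF V, of x] that y by auto
  ultimately show ?thesis using V by (subst image_insert, subst card_insert_disjoint) auto
qed

text \<open>Taking in y as a fixed point creates one cycle, and the transposition merges it at once
  with that of x.\<close>

lemma card_orbits_transpose_new:
  assumes V: "finite V" "p permutes V" and xy: "x \<in> V" "y \<notin> V"
  shows "card (orbit (p \<circ> transpose x y) ` insert y V) = card (orbit p ` V)"
proof -
  have p': "p permutes insert y V" using V(2) by (rule permutes_subset) auto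
  have "y \<notin> orbit p x" using permutes_orbit_subset[OF V(2) xy(1)] xy by blast
  then show ?thesis
    using card_orbits_transpose(1)[OF _ p', of x y] card_orbits_insert_fixed[OF V xy(2)] V xy
    by (metis finite_insert insertCI nat.inject)
qed

section \<open>Products along walks\<close>

text \<open>Walks and step sequences are lists with the most recent entry first, so the walk of a tuple
  \<^term>\<open>is\<close> is \<^term>\<open>hd is # rev is\<close>.\<close>

fun wprod :: "nat list \<Rightarrow> nat \<Rightarrow> nat" where
  "wprod [] = id"
| "wprod [x] = id"
| "wprod (y # x # w) = wprod (x # w) \<circ> tr0 x y"

text \<open>This is b + c of the overview. The value 0 is not counted as a letter, since every
  transposition with it is read as the identity.\<close>

definition walk_pot :: "nat list \<Rightarrow> nat" where
  "walk_pot w = card (set w - {0}) + card (orbit (wprod w) ` (set w - {0}))"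

text \<open>The second argument is the cycle of the current letter, on top, seen as a stack; the third
  lists the steps, 0 for a push and d > 0 for a pop of d letters.\<close>

inductive planar_walk :: "nat list \<Rightarrow> nat list \<Rightarrow> nat list \<Rightarrow> bool" where
  start: "v \<noteq> 0 \<Longrightarrow> planar_walk [v] [v] []"
| push: "planar_walk w st s \<Longrightarrow> y \<notin> set w \<Longrightarrow> y \<noteq> 0 \<Longrightarrow> planar_walk (y # w) (y # st) (0 # s)"
| pop: "planar_walk w (x # u @ y # st) s \<Longrightarrow> planar_walk (y # w) (y # st) (Suc (length u) # s)"

text \<open>In a planar walk these are the lengths of the cycles split off so far, those of length
  one included.\<close>

definition pops :: "nat list \<Rightarrow> nat multiset" where
  "pops s = filter_mset (\<lambda>d. d \<noteq> 0) (mset s)"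

lemma pops_simps [simp]:
  "pops [] = {#}" "pops (0 # s) = pops s" "pops (Suc d # s) = add_mset (Suc d) (pops s)"
  by (simp_all add: pops_def)

section \<open>Change of the potential in a single step\<close>

lemma wprod_permutes: "wprod w permutes (set w - {0})"
proof (induction w rule: induct_list012)
  case (3 y x w)
  have "wprod (x # w) permutes (set (y # x # w) - {0})"
    using 3(2) by (rule permutes_subset) auto
  moreover have "tr0 x y permutes (set (y # x # w) - {0})"
    by (auto simp: tr0_def permutes_id intro: permutes_swap_id)
  ultimately show ?case by (simp only: wprod.simps permutes_compose)
qed (auto simp: permutes_def)

text \<open>A step from or to 0 multiplies by the identity; it matters only when it reaches a new
  letter, which counts once as a letter and once as a cycle. The remaining cases are insertion,
  merge and split.\<close>

lemma walk_pot_step: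
  fixes y x :: nat and w :: "nat list"
  defines "w' \<equiv> x # w"
  shows "y = 0 \<Longrightarrow> walk_pot (y # w') = walk_pot w'"
    and "y \<noteq> 0 \<Longrightarrow> x = 0 \<Longrightarrow> y \<notin> set w' \<Longrightarrow> walk_pot (y # w') = walk_pot w' + 2"
    and "x = 0 \<Longrightarrow> y \<in> set w' \<Longrightarrow> walk_pot (y # w') = walk_pot w'"
    and "y \<noteq> 0 \<Longrightarrow> x \<noteq> 0 \<Longrightarrow> y \<notin> set w' \<Longrightarrow> walk_pot (y # w') = walk_pot w' + 1"
    and "y \<noteq> 0 \<Longrightarrow> x \<noteq> 0 \<Longrightarrow> x \<noteq> y \<Longrightarrow> y \<in> set w' \<Longrightarrow> y \<notin> orbit (wprod w') x \<Longrightarrow>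
           walk_pot w' = walk_pot (y # w') + 1"
    and "y \<noteq> 0 \<Longrightarrow> x \<noteq> 0 \<Longrightarrow> x \<noteq> y \<Longrightarrow> y \<in> set w' \<Longrightarrow> y \<in> orbit (wprod w') x \<Longrightarrow>
           walk_pot (y # w') = walk_pot w' + 1"
proof -
  define V where "V = set w' - {0}"
  have V: "finite V" "wprod w' permutes V"
    using wprod_permutes by (auto simp: V_def)
  have step: "wprod (y # w') = wprod w' \<circ> tr0 x y" by (simp add: w'_def)
  show "walk_pot (y # w') = walk_pot w'" if "y = 0"
    using that unfolding walk_pot_def step by (simp add: tr0_def)
  show "walk_pot (y # w') = walk_pot w'" if "x = 0" "y \<in> set w'"
    using that unfolding walk_pot_def step by (simp add: tr0_def insert_absorb)
  show "walk_pot (y # w') = walk_pot w' + 2" if "y \<noteq> 0" "x = 0" "y \<notin> set w'"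
  proof -
    have "set (y # w') - {0} = insert y V" "y \<notin> V" using that by (auto simp: V_def)
    then show ?thesis
      using card_orbits_insert_fixed[OF V, of y] V(1) that
      by (simp add: walk_pot_def step tr0_def flip: V_def)
  qed
  show "walk_pot (y # w') = walk_pot w' + 1" if "y \<noteq> 0" "x \<noteq> 0" "y \<notin> set w'"
  proof -
    have "set (y # w') - {0} = insert y V" "y \<notin> V" "x \<in> V" using that by (auto simp: V_def w'_def)
    then show ?thesis
      using card_orbits_transpose_new[OF V, of x y] V(1) that
      by (simp add: walk_pot_def step tr0_def flip: V_def)
  qed
  show "walk_pot w' = walk_pot (y # w') + 1"
    if "y \<noteq> 0" "x \<noteq> 0" "x \<noteq> y" "y \<in> set w'" "y \<notin> orbit (wprod w') x"
  proof -
    have "set (y # w') - {0} = V" "y \<in> V" "x \<in> V" using that by (auto simp: V_def w'_def)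
    then show ?thesis
      using card_orbits_transpose(1)[OF V, of x y] V(1) that
      by (simp add: walk_pot_def step tr0_def flip: V_def)
  qed
  show "walk_pot (y # w') = walk_pot w' + 1"
    if "y \<noteq> 0" "x \<noteq> 0" "x \<noteq> y" "y \<in> set w'" "y \<in> orbit (wprod w') x"
  proof -
    have "set (y # w') - {0} = V" "y \<in> V" "x \<in> V" using that by (auto simp: V_def w'_def)
    then show ?thesis
      using card_orbits_transpose(2)[OF V, of x y] V(1) that
      by (simp add: walk_pot_def step tr0_def flip: V_def)
  qed
qed

text \<open>The quantity that behaves uniformly is the potential, lowered by one when the current
  letter is nonzero: it changes by an odd amount and rises by at most one, whether or not the step
  touches 0.\<close>

lemma walk_pot_step_bounds:
  assumes "x \<noteq> y"
  shows "walk_pot (y # x # w) + of_bool (x \<noteq> 0) \<le> walk_pot (x # w) + 1 + of_bool (y \<noteq> 0)"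
    and "even (walk_pot (y # x # w) + walk_pot (x # w) + 1 + of_bool (x \<noteq> 0) + of_bool (y \<noteq> 0))"
proof -
  consider "y = 0" | "y \<noteq> 0" "x = 0" "y \<notin> set (x # w)" | "y \<noteq> 0" "x = 0" "y \<in> set (x # w)"
    | "y \<noteq> 0" "x \<noteq> 0" "y \<notin> set (x # w)"
    | "y \<noteq> 0" "x \<noteq> 0" "y \<in> set (x # w)" "y \<notin> orbit (wprod (x # w)) x"
    | "y \<noteq> 0" "x \<noteq> 0" "y \<in> set (x # w)" "y \<in> orbit (wprod (x # w)) x"
    by blast
  then have "walk_pot (y # x # w) + of_bool (x \<noteq> 0) \<le> walk_pot (x # w) + 1 + of_bool (y \<noteq> 0) \<and>
    even (walk_pot (y # x # w) + walk_pot (x # w) + 1 + of_bool (x \<noteq> 0) + of_bool (y \<noteq> 0))"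
  proof cases
    case 1
    then show ?thesis using walk_pot_step(1)[of y x w] assms by simp
  next
    case 2
    then show ?thesis using walk_pot_step(2)[of y x w] by simp
  next
    case 3
    then show ?thesis using walk_pot_step(3)[of x y w] by simp
  next
    case 4
    then show ?thesis using walk_pot_step(4)[of y x w] by simp
  next
    case 5
    then show ?thesis using walk_pot_step(5)[of y x w] assms by simp
  next
    case 6
    then show ?thesis using walk_pot_step(6)[of y x w] assms by simp
  qed
  then show "walk_pot (y # x # w) + of_bool (x \<noteq> 0) \<le> walk_pot (x # w) + 1 + of_bool (y \<noteq> 0)"
    "even (walk_pot (y # x # w) + walk_pot (x # w) + 1 + of_bool (x \<noteq> 0) + of_bool (y \<noteq> 0))"
    by blast+
qed

text \<open>The parities of the single steps add up. In a closed walk the two end corrections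
  cancel, so the potential has the parity of the number of steps.\<close>

lemma walk_pot_parity:
  assumes "w \<noteq> []" "distinct_adj w"
  shows "even (walk_pot w + length w + 1 + of_bool (hd w \<noteq> 0) + of_bool (last w \<noteq> 0))"
  using assms
proof (induction w rule: induct_list012)
  case (2 x)
  show ?case by (simp add: walk_pot_def)
next
  case (3 y x w)
  then have "even (walk_pot (x # w) + length (x # w) + 1 + of_bool (x \<noteq> 0) + of_bool (last (x # w) \<noteq> 0))"
    by simp
  moreover have "x \<noteq> y" using 3(4) by auto
  ultimately have "even ((walk_pot (x # w) + length (x # w) + 1 + of_bool (x \<noteq> 0) + of_bool (last (x # w) \<noteq> 0))
    + (walk_pot (y # x # w) + walk_pot (x # w) + 1 + of_bool (x \<noteq> 0) + of_bool (y \<noteq> 0)))"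
    using walk_pot_step_bounds(2)[of x y w] by (metis even_add)
  moreover have "(walk_pot (x # w) + length (x # w) + 1 + of_bool (x \<noteq> 0) + of_bool (last (x # w) \<noteq> 0))
    + (walk_pot (y # x # w) + walk_pot (x # w) + 1 + of_bool (x \<noteq> 0) + of_bool (y \<noteq> 0))
    = (walk_pot (y # x # w) + length (y # x # w) + 1 + of_bool (hd (y # x # w) \<noteq> 0)
        + of_bool (last (y # x # w) \<noteq> 0))
      + 2 * (walk_pot (x # w) + of_bool (x \<noteq> 0))"
    by simp
  ultimately show ?case by (metis dvd_triv_left even_add)
qed simp

text \<open>The list runs against p: each entry is sent to its predecessor, the head to the last
  entry. This fits a stack with the newest letter on top, because multiplying by
  \<open>transpose x y\<close> sends the old top x to the newly pushed y.\<close>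

definition cyclic_list :: "('a \<Rightarrow> 'a) \<Rightarrow> 'a list \<Rightarrow> bool" where
  "cyclic_list p u \<longleftrightarrow> u \<noteq> [] \<and> map p (rotate1 u) = u"

lemma cyclic_list_cong:
  assumes "cyclic_list p u" "\<And>z. z \<in> set u \<Longrightarrow> q z = p z"
  shows "cyclic_list q u"
proof -
  have "map q (rotate1 u) = map p (rotate1 u)"
    using assms(2) by (intro map_cong) auto
  then show ?thesis using assms(1) unfolding cyclic_list_def by presburger
qed

text \<open>From the head z, p jumps to the last entry and then goes back through the list one entry
  at a time, so the orbit of z exhausts u; it cannot leave u because p maps the set of entries onto
  itself.\<close>

lemma cyclic_list_orbit:
  assumes V: "finite V" "p permutes V" and u: "cyclic_list p u" and x: "x \<in> set u"
  shows "orbit p x = set u"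
proof -
  obtain z t where zt: "u = z # t" using u by (cases u) (auto simp: cyclic_list_def)
  have eq: "map p (t @ [z]) = z # t" using u zt by (simp add: cyclic_list_def)
  have img: "p ` set u = set u"
    using arg_cong[OF eq, of set] zt by simp
  have z: "p z = last u" using arg_cong[OF eq, of last] zt by simp
  have nth: "p (u ! Suc i) = u ! i" if "Suc i < length u" for i
    using arg_cong[OF eq, of "\<lambda>l. l ! i"] that zt by (simp add: nth_append)
  have reach: "u ! (length u - 1 - i) \<in> orbit p z" if "i < length u" for i
    using that
  proof (induction i)
    case 0
    have "u ! (length u - 1) = p z" using z zt by (simp add: last_conv_nth)
    then show ?case by (simp add: orbit.base)
  next
    case (Suc i)
    have "p (u ! (length u - 1 - i)) = u ! (length u - 1 - Suc i)"
      using nth[of "length u - 1 - Suc i"] Suc.prems by (simp add: Suc_diff_Suc)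
    then show ?case using Suc by (metis Suc_lessD orbit.step)
  qed
  have sub: "set u \<subseteq> orbit p z"
  proof
    fix y assume "y \<in> set u"
    then obtain j where "j < length u" "y = u ! j" by (auto simp: in_set_conv_nth)
    then show "y \<in> orbit p z" using reach[of "length u - 1 - j"] by simp
  qed
  have "y \<in> set u" if "y \<in> orbit p z" for y
    using that by induction (use img zt in auto)
  then have "orbit p z = set u" using sub by blast
  moreover have "orbit p x = orbit p z"
    using orbit_eq_iff_mem[OF V] sub x by blast
  ultimately show ?thesis by simp
qed

text \<open>The last two equations are the bookkeeping used throughout: after the initial letter
  every step adds a letter or is a pop, and every letter is still on the stack or was removed by
  exactly one pop.\<close>

lemma planar_walk_basic:
  assumes "planar_walk w st s"
  shows "w \<noteq> [] \<and> st \<noteq> [] \<and> hd st = hd w \<and> last st = last w \<and> distinct st \<and> set st \<subseteq> set w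
    \<and> 0 \<notin> set w \<and> length w = Suc (length s) \<and> distinct_adj w
    \<and> card (set w) + size (pops s) = length w \<and> length st + sum_mset (pops s) = card (set w)"
  using assms
proof induction
  case (push w st s y)
  then show ?case by (auto simp: distinct_adj_Cons)
next
  case (pop w x u y st s)
  then show ?case by (auto simp: distinct_adj_Cons insert_absorb)
qed auto

text \<open>Here \<open>cs\<close> collects the completed cycles. A push extends the list of the
  current cycle at its head, a pop cuts that list in two and moves the upper piece to
  \<open>cs\<close>.\<close>

lemma planar_walk_cycles:
  assumes "planar_walk w st s"
  shows "\<exists>cs. distinct (concat (st # cs)) \<and> set (concat (st # cs)) = set w \<and>
    (\<forall>u \<in> set (st # cs). cyclic_list (wprod w) u) \<and> mset (map length cs) = pops s"
  using assms
proof induction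
  case (start v)
  show ?case by (rule exI[of _ "[]"]) (auto simp: cyclic_list_def)
next
  case (push w st s y)
  from push.IH obtain cs where cs: "distinct (concat (st # cs))" "set (concat (st # cs)) = set w"
    "\<forall>u \<in> set (st # cs). cyclic_list (wprod w) u" "mset (map length cs) = pops s" by blast
  note b = planar_walk_basic[OF push.hyps(1)]
  obtain x t where st: "st = x # t" using b by (cases st) auto
  obtain w0 where w: "w = x # w0" using b st by (cases w) auto
  have x0: "x \<noteq> 0" using b w by auto
  define p where "p = wprod w"
  have q: "wprod (y # w) = p \<circ> transpose x y"
    using push.hyps x0 by (simp add: w p_def tr0_def)
  have py: "p y = y" using permutes_not_in[OF wprod_permutes, of y w] push.hyps by (simp add: p_def)
  have xt: "x \<notin> set t" using cs(1) st by auto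
  have "cyclic_list p st" using cs(3) p_def by auto
  then have eq: "map p (t @ [x]) = x # t" by (simp add: cyclic_list_def st)
  have same: "(p \<circ> transpose x y) z = p z" if "z \<noteq> x" "z \<in> set w" for z
    using that push.hyps(2) by (auto simp: transpose_def)
  have tw: "set t \<subseteq> set w" using b st by auto
  have "map (p \<circ> transpose x y) (st @ [y]) = y # st"
  proof -
    have "map (p \<circ> transpose x y) t = map p t"
    proof (rule map_cong[OF refl])
      show "(p \<circ> transpose x y) z = p z" if "z \<in> set t" for z
        using that xt tw by (intro same) auto
    qed
    then show ?thesis using eq py by (simp add: st del: map_map map_eq_conv)
  qed
  then have "cyclic_list (wprod (y # w)) (y # st)" by (simp add: cyclic_list_def q)
  moreover have "cyclic_list (wprod (y # w)) u" if "u \<in> set cs" for u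
    unfolding q
  proof (rule cyclic_list_cong)
    show "cyclic_list p u" using cs(3) that by (simp add: p_def)
    show "(p \<circ> transpose x y) z = p z" if "z \<in> set u" for z
      using cs(1,2) that st \<open>u \<in> set cs\<close> by (intro same) auto
  qed
  moreover have "distinct (concat ((y # st) # cs))" "set (concat ((y # st) # cs)) = set (y # w)"
    using cs(1,2) push.hyps(2) by auto
  ultimately show ?case using cs(4) by (intro exI[of _ cs]) auto
next
  case (pop w x u y t s)
  from pop.IH obtain cs where cs: "distinct (concat ((x # u @ y # t) # cs))"
    "set (concat ((x # u @ y # t) # cs)) = set w"
    "\<forall>v \<in> set ((x # u @ y # t) # cs). cyclic_list (wprod w) v" "mset (map length cs) = pops s"
    by blast
  note b = planar_walk_basic[OF pop.hyps(1)]
  obtain w0 where w: "w = x # w0" using b by (cases w) auto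
  have x0: "x \<noteq> 0" "y \<noteq> 0" using b w by auto
  define p where "p = wprod w"
  have q: "wprod (y # w) = p \<circ> transpose x y"
    using x0 by (simp add: w p_def tr0_def)
  have "cyclic_list p (x # u @ y # t)" using cs(3) p_def by auto
  \<comment> \<open>The cyclic relation for the whole stack is read in two pieces of matching
    lengths. Each piece ends in the wrong one of x and y, so exchanging these two closes both pieces
    into cycles.\<close>
  then have app: "map p (u @ [y]) @ map p (t @ [x]) = (x # u) @ (y # t)" by (simp add: cyclic_list_def)
  have "length (map p (u @ [y])) = length (x # u)" by simp
  from iffD1[OF append_eq_append_conv[OF disjI1[OF this]] app]
  have eq: "map p (u @ [y]) = x # u" "map p (t @ [x]) = y # t" by blast+
  have same: "(p \<circ> transpose x y) z = p z" if "z \<noteq> x" "z \<noteq> y" for z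
    using that by (auto simp: transpose_def)
  have same_map: "map (p \<circ> transpose x y) l = map p l" if "x \<notin> set l" "y \<notin> set l" for l
    using that by (intro map_cong[OF refl] same) auto
  have "map (p \<circ> transpose x y) u = map p u" "map (p \<circ> transpose x y) t = map p t"
    using cs(1) by (auto intro!: same_map simp del: map_eq_conv)
  then have "map (p \<circ> transpose x y) (u @ [x]) = x # u" "map (p \<circ> transpose x y) (t @ [y]) = y # t"
    using eq by (simp_all del: map_eq_conv map_map)
  then have "cyclic_list (wprod (y # w)) (x # u)" "cyclic_list (wprod (y # w)) (y # t)"
    by (simp_all add: cyclic_list_def q)
  moreover have "cyclic_list (wprod (y # w)) v" if "v \<in> set cs" for v
    unfolding q
  proof (rule cyclic_list_cong)
    show "cyclic_list p v" using cs(3) that by (simp add: p_def)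
    show "(p \<circ> transpose x y) z = p z" if "z \<in> set v" for z
      using cs(1) that \<open>v \<in> set cs\<close> by (intro same) auto
  qed
  moreover have "distinct (concat ((y # t) # (x # u) # cs))"
    "set (concat ((y # t) # (x # u) # cs)) = set (y # w)"
    using cs(1,2) by auto
  ultimately show ?case using cs(4) by (intro exI[of _ "(x # u) # cs"]) auto
qed

text \<open>In contrast to \<open>cyc_type\<close>, fixed points in V are kept, so that size and sum
  of the multiset count cycles and letters.\<close>

definition cycle_lengths :: "('a \<Rightarrow> 'a) \<Rightarrow> 'a set \<Rightarrow> nat multiset" where
  "cycle_lengths p V = image_mset card (mset_set (orbit p ` V))"

lemma distinct_map_set_of_distinct_concat:
  assumes "distinct (concat L)" "[] \<notin> set L"
  shows "distinct (map set L)"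
  using assms
proof (induction L)
  case (Cons u L)
  have "set u \<notin> set ` set L"
  proof
    assume "set u \<in> set ` set L"
    then obtain v where "v \<in> set L" "set u = set v" by blast
    moreover have "u \<noteq> []" using Cons.prems(2) by auto
    then have "hd u \<in> set u" by simp
    ultimately show False using Cons.prems(1) by auto
  qed
  then show ?case using Cons by simp
qed simp

text \<open>The stack and the completed cycles are disjoint nonempty lists covering all letters, so
  each orbit arises from exactly one of them.\<close>

lemma planar_walk_cycle_lengths:
  assumes "planar_walk w st s"
  shows "cycle_lengths (wprod w) (set w) = add_mset (length st) (pops s)"
    and "y \<in> set st \<Longrightarrow> orbit (wprod w) y = set st"
proof -
  obtain cs where cs: "distinct (concat (st # cs))" "set (concat (st # cs)) = set w"
    "\<forall>u \<in> set (st # cs). cyclic_list (wprod w) u" "mset (map length cs) = pops s"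
    using planar_walk_cycles[OF assms] by blast
  define L where "L = st # cs"
  note V = finite_Diff[OF finite_set[of w]] wprod_permutes[of w]
  have orb: "orbit (wprod w) y = set u" if "u \<in> set L" "y \<in> set u" for u y
    using cyclic_list_orbit[OF V] cs(3) that by (auto simp: L_def)
  show "y \<in> set st \<Longrightarrow> orbit (wprod w) y = set st" using orb by (simp add: L_def)
  have ne: "u \<noteq> []" if "u \<in> set L" for u using cs(3) that by (auto simp: L_def cyclic_list_def)
  have "orbit (wprod w) ` set w = set (map set L)"
  proof -
    have "set w = (\<Union>u\<in>set L. set u)" using cs(2) by (auto simp: L_def)
    then have "orbit (wprod w) ` set w = (\<Union>u\<in>set L. orbit (wprod w) ` set u)"
      by (simp only: image_UN)
    also have "\<dots> = (\<Union>u\<in>set L. {set u})"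
    proof (rule SUP_cong[OF refl])
      fix u assume u: "u \<in> set L"
      then show "orbit (wprod w) ` set u = {set u}"
        using orb[OF u] ne[OF u] by (auto simp: image_constant_conv cong: image_cong)
    qed
    finally show ?thesis by auto
  qed
  then have "mset_set (orbit (wprod w) ` set w) = mset (map set L)"
    using distinct_map_set_of_distinct_concat[of L] cs(1) ne
    unfolding L_def by (metis mset_set_set)
  then have "cycle_lengths (wprod w) (set w) = mset (map card (map set L))"
    by (simp add: cycle_lengths_def multiset.map_comp)
  also have "\<dots> = mset (map length L)"
  proof -
    have "card (set u) = length u" if "u \<in> set L" for u
      using that cs(1) by (auto simp: L_def distinct_concat_iff intro: distinct_card)
    then have "map card (map set L) = map length L" by simp
    then show ?thesis by (rule arg_cong)
  qed
  finally show "cycle_lengths (wprod w) (set w) = add_mset (length st) (pops s)"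
    using cs(4) by (simp add: L_def)
qed

lemma size_cycle_lengths: "size (cycle_lengths p V) = card (orbit p ` V)"
  by (simp add: cycle_lengths_def)

lemma sum_cycle_lengths:
  assumes V: "finite V" "p permutes V"
  shows "sum_mset (cycle_lengths p V) = card V"
proof -
  have "\<Union>(orbit p ` V) = V"
    using permutes_orbit_subset[OF V(2)] permutes_orbit_self[OF V] by blast
  moreover have "card (\<Union>(orbit p ` V)) = sum card (orbit p ` V)"
  proof (rule card_Union_disjoint)
    show "disjoint (orbit p ` V)"
    proof (rule disjointI)
      fix C D assume "C \<in> orbit p ` V" "D \<in> orbit p ` V" "C \<noteq> D"
      then obtain x y where "C = orbit p x" "D = orbit p y" by blast
      then show "C \<inter> D = {}" using \<open>C \<noteq> D\<close> orbit_eq_iff_mem[OF V] by blast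
    qed
    show "finite A" if "A \<in> orbit p ` V" for A
      using that permutes_orbit_subset[OF V(2)] finite_subset[OF _ V(1)] by blast
  qed
  ultimately show ?thesis by (simp add: cycle_lengths_def sum_unfold_sum_mset)
qed

text \<open>There is one cycle per pop and one for the stack, while letters and pops together make
  up the length. This is the extremal value of the overview.\<close>

lemma planar_walk_pot:
  assumes "planar_walk w st s"
  shows "walk_pot w = Suc (length w)"
proof -
  note b = planar_walk_basic[OF assms]
  have "set w - {0} = set w" using b by auto
  then have "walk_pot w = card (set w) + Suc (size (pops s))"
    using planar_walk_cycle_lengths(1)[OF assms] size_cycle_lengths[of "wprod w" "set w"]
    by (simp add: walk_pot_def)
  then show ?thesis using b by simp
qed

text \<open>The set A of the second case is the component left at the first visit to 0. It stays a union of
  cycles until the walk comes back to it, and coming back costs at least one; since A contains the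
  initial letter, a closed walk must come back.\<close>

lemma walk_trichotomy:
  assumes "w \<noteq> []" "distinct_adj w"
  shows "(\<exists>st s. planar_walk w st s)
    \<or> (\<exists>A. last w \<in> A \<and> A \<subseteq> set w - {0} \<and> wprod w ` A \<subseteq> A \<and> hd w \<notin> A
          \<and> walk_pot w \<le> length w + of_bool (hd w \<noteq> 0))
    \<or> walk_pot w + 1 \<le> length w + of_bool (hd w \<noteq> 0)"
    (is "?P w \<or> (\<exists>A. ?Q A w) \<or> ?R w")
  using assms
proof (induction w rule: induct_list012)
  case (2 x)
  show ?case
  proof (cases "x = 0")
    case True
    then show ?thesis by (simp add: walk_pot_def)
  next
    case False
    then show ?thesis using planar_walk.start by blast
  qed
next
  case (3 y x w)
  have xy: "x \<noteq> y" using 3 by auto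
  have "?P (x # w) \<or> (\<exists>A. ?Q A (x # w)) \<or> ?R (x # w)" using 3(2,4) by simp
  then consider (P) "?P (x # w)" | (Q) "\<exists>A. ?Q A (x # w)" | (R) "?R (x # w)" by blast
  then show ?case
  proof cases
    case P
    then obtain st s where G: "planar_walk (x # w) st s" by blast
    note b = planar_walk_basic[OF G] and pot = planar_walk_pot[OF G]
    have x0: "x \<noteq> 0" using b by auto
    consider "y = 0" | "y \<noteq> 0" "y \<notin> set (x # w)" | "y \<noteq> 0" "y \<in> set st"
      | "y \<noteq> 0" "y \<in> set (x # w)" "y \<notin> set st" by blast
    then show ?thesis
    proof cases
      case 1
      have "last (y # x # w) \<in> set (x # w)" by (metis last_ConsR last_in_set list.distinct(1))
      moreover have "wprod (y # x # w) ` set (x # w) \<subseteq> set (x # w)"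
        using permutes_image[OF wprod_permutes[of "x # w"]] b 1 by (auto simp: tr0_def)
      ultimately have "?Q (set (x # w)) (y # x # w)"
        using b 1 pot walk_pot_step(1)[of y x w] by auto
      then show ?thesis by blast
    next
      case 2
      then show ?thesis using planar_walk.push[OF G] by blast
    next
      case 3
      then obtain u0 t where "st = u0 @ y # t" by (meson split_list)
      moreover have "hd st = x" using b by simp
      ultimately obtain u where "st = x # u @ y # t" using xy by (cases u0) auto
      then show ?thesis using planar_walk.pop[of "x # w" x u y t s] G by blast
    next
      case 4
      have "hd st = x" "st \<noteq> []" using b by auto
      then have "x \<in> set st" by (metis hd_in_set)
      \<comment> \<open>A visited letter off the stack belongs to a completed cycle, so this step is
        a merge.\<close>
      then have "y \<notin> orbit (wprod (x # w)) x"
        using planar_walk_cycle_lengths(2)[OF G] 4 by simp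
      then have "?R (y # x # w)"
        using walk_pot_step(5)[of y x w] x0 xy 4 pot by (simp del: wprod.simps)
      then show ?thesis by blast
    qed
  next
    case Q
    then obtain A where A: "?Q A (x # w)" by blast
    show ?thesis
    proof (cases "y \<in> A")
      case False
      \<comment> \<open>Neither end of the step lies in A, so the transposition fixes A pointwise
        and A stays invariant.\<close>
      have "wprod (y # x # w) z = wprod (x # w) z" if "z \<in> A" for z
      proof -
        have "z \<noteq> x" "z \<noteq> y" using that A False by auto
        then show ?thesis by (simp add: tr0_def transpose_def)
      qed
      then have "wprod (y # x # w) ` A \<subseteq> A" using A by (auto simp del: wprod.simps)
      then have "?Q A (y # x # w)"
        using A False walk_pot_step_bounds(1)[OF xy, of w] by (auto simp del: wprod.simps)
      then show ?thesis by blast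
    next
      case True
      then have y: "y \<noteq> 0" "y \<in> set (x # w)" using A by auto
      have "?R (y # x # w)"
      proof (cases "x = 0")
        case True
        then show ?thesis using walk_pot_step(3)[of x y w] A y by (simp del: wprod.simps)
      next
        case False
        \<comment> \<open>The invariant set A contains the whole cycle of y but not x, so this step
          is a merge.\<close>
        have "z \<in> A" if "z \<in> orbit (wprod (x # w)) y" for z
          using that by induction (use A True in \<open>auto simp del: wprod.simps\<close>)
        then have "x \<notin> orbit (wprod (x # w)) y" using A by auto
        then have "y \<notin> orbit (wprod (x # w)) x"
          using orbit_eq_iff_mem[OF finite_Diff[OF finite_set[of "x # w"]] wprod_permutes[of "x # w"]]
          by metis
        then show ?thesis
          using walk_pot_step(5)[of y x w] False xy A y by (simp del: wprod.simps)
      qed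
      then show ?thesis by blast
    qed
  next
    case R
    then have "?R (y # x # w)" using walk_pot_step_bounds(1)[OF xy, of w] by (simp del: wprod.simps)
    then show ?thesis by blast
  qed
qed simp

section \<open>Cycle types of tuples\<close>

lemma foldr_comp_append:
  "foldr (\<circ>) (fs @ gs) id = foldr (\<circ>) fs id \<circ> foldr (\<circ>) gs id"
  by (induction fs) (auto simp: comp_assoc)

lemma zip_tl_snoc:
  "xs \<noteq> [] \<Longrightarrow> zip (xs @ [y]) (tl (xs @ [y])) = zip xs (tl xs) @ [(last xs, y)]"
  by (induction xs rule: induct_list012) auto

lemma foldr_tr0_eq_wprod:
  "foldr (\<circ>) (map (\<lambda>(a, b). tr0 a b) (zip xs (tl xs))) id = wprod (rev xs)"
proof (induction xs rule: rev_induct)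
  case (snoc y xs)
  show ?case
  proof (cases "xs = []")
    case False
    then obtain x zs where "rev xs = x # zs" by (cases "rev xs") auto
    moreover from this have "last xs = x" by (metis hd_rev list.sel(1))
    ultimately show ?thesis
      unfolding zip_tl_snoc[OF False] map_append foldr_comp_append snoc.IH by simp
  qed simp
qed simp

lemma tuple_prod_eq_wprod:
  assumes "is \<noteq> []"
  shows "tuple_prod is = wprod (hd is # rev is)"
proof -
  have "zip (is @ [hd is]) (tl (is @ [hd is])) = zip is (tl is @ [hd is])"
    using assms zip_append1[of "is" "[hd is]" "tl is @ [hd is]"] by (cases "is") simp_all
  then show ?thesis
    using foldr_tr0_eq_wprod[of "is @ [hd is]"] by (simp add: tuple_prod_def)
qed

text \<open>Points outside V are fixed, and the filter drops their cycles; hence the type can be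
  read off the visited letters alone.\<close>

lemma cyc_type_eq_filter_cycle_lengths:
  assumes V: "V \<subseteq> {1..n}" "p permutes V"
  shows "cyc_type n p = filter_mset (\<lambda>m. 2 \<le> m) (cycle_lengths p V)"
proof -
  have "{C \<in> orbit p ` {1..n}. 2 \<le> card C} = {C \<in> orbit p ` V. 2 \<le> card C}"
  proof -
    have "x \<in> V" if "2 \<le> card (orbit p x)" for x
    proof (rule ccontr)
      assume "x \<notin> V"
      then have "orbit p x = {x}" using permutes_not_in[OF V(2)] by (simp add: orbit_eq_singleton_iff)
      then show False using that by simp
    qed
    then show ?thesis using V(1) by blast
  qed
  moreover have "finite V" using V(1) finite_subset by blast
  ultimately show ?thesis
    by (simp add: cyc_type_def cycle_lengths_def filter_mset_image_mset)
qed

lemma filter_ge2_split: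
  fixes M :: "nat multiset"
  assumes "0 \<notin># M"
  shows "M = filter_mset (\<lambda>m. 2 \<le> m) M + replicate_mset (count M 1) 1"
proof (rule multiset_eqI)
  fix x :: nat
  have "count M 0 = 0" using assms by (simp add: not_in_iff)
  moreover have "x = 0 \<or> x = 1 \<or> 2 \<le> x" by linarith
  ultimately show "count M x = count (filter_mset (\<lambda>m. 2 \<le> m) M + replicate_mset (count M 1) 1) x"
    by auto
qed

lemma filter_ge2_sum_size:
  fixes M :: "nat multiset"
  assumes "0 \<notin># M" "L = filter_mset (\<lambda>m. 2 \<le> m) M"
  shows "sum_mset M = sum_mset L + count M 1" "size M = size L + count M 1"
  using arg_cong[OF filter_ge2_split[OF assms(1)], of sum_mset]
    arg_cong[OF filter_ge2_split[OF assms(1)], of size] assms(2)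
  by simp_all

lemma adm_tuple_walk:
  assumes "is \<in> adm_tuples n k" "2 \<le> k"
  shows "is \<noteq> []" "distinct_adj (hd is # rev is)" "last (hd is # rev is) = hd is"
    "set is \<subseteq> {0..n}" "length is = k"
proof -
  show ne: "is \<noteq> []" and "set is \<subseteq> {0..n}" and len: "length is = k"
    using assms by (auto simp: adm_tuples_def)
  show "last (hd is # rev is) = hd is" using ne by (simp add: last_rev)
  have "distinct_adj is" using assms by (simp add: adm_tuples_def distinct_adj_conv_nth)
  moreover have "last is \<noteq> hd is"
    using assms ne by (simp add: adm_tuples_def last_conv_nth hd_conv_nth)
  ultimately have "distinct_adj (is @ [hd is])" by (simp add: distinct_adj_append_iff)
  then have "distinct_adj (rev (is @ [hd is]))" by (simp only: distinct_adj_rev)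
  then show "distinct_adj (hd is # rev is)" by simp
qed

text \<open>The initial letter never leaves the bottom of the stack. If it is also on top,
  distinctness leaves room for nothing else.\<close>

lemma planar_walk_closed_stack:
  assumes "planar_walk w st s" "last w = hd w"
  shows "st = [hd w]"
proof -
  note b = planar_walk_basic[OF assms(1)]
  then obtain t where "st = hd w # t" by (cases st) auto
  moreover have "t = []"
    using b assms(2) \<open>st = _\<close> last_in_set[of t] by (cases "t = []") auto
  ultimately show ?thesis by simp
qed

lemma size_pops: "size (pops s) + count_list s 0 = length s"
  by (induction s) (auto simp: pops_def)

lemma zero_notin_pops: "0 \<notin># pops s"
  by (simp add: pops_def)

lemma closed_planar_walk_pops:
  assumes "planar_walk w st s" "last w = hd w"
  shows "sum_mset (pops s) + size (pops s) = length s"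
  using planar_walk_basic[OF assms(1)] planar_walk_closed_stack[OF assms] by auto

lemma planar_tuple_cyc_type:
  assumes "is \<noteq> []" "set is \<subseteq> {1..n}" "planar_walk (hd is # rev is) [hd is] s"
  shows "cyc_type n (tuple_prod is) = filter_mset (\<lambda>m. 2 \<le> m) (pops s)"
proof -
  define w where "w = hd is # rev is"
  have w: "set w = set is" using assms(1) by (auto simp: w_def)
  have "0 \<notin> set w" using planar_walk_basic[OF assms(3)] by (simp add: w_def)
  then have "wprod w permutes set w" using wprod_permutes[of w] by simp
  then have "cyc_type n (wprod w) = filter_mset (\<lambda>m. 2 \<le> m) (cycle_lengths (wprod w) (set w))"
    using w assms(2) by (intro cyc_type_eq_filter_cycle_lengths) simp_all
  \<comment> \<open>The remaining one-letter stack is a fixed point, which the filter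
    removes.\<close>
  also have "cycle_lengths (wprod w) (set w) = add_mset 1 (pops s)"
    using planar_walk_cycle_lengths(1)[OF assms(3)] by (simp add: w_def)
  finally show ?thesis
    using tuple_prod_eq_wprod[OF assms(1)] by (simp add: w_def)
qed

text \<open>A closed walk that is not planar falls short of the extremal potential, and parity makes
  the shortfall at least two. Expressed through the cycle type, this limits both the type and the
  number of letters.\<close>

lemma adm_tuple_dichotomy:
  assumes adm: "is \<in> adm_tuples n k" "2 \<le> k"
  defines "lam \<equiv> cyc_type n (tuple_prod is)"
  shows "(\<exists>s. planar_walk (hd is # rev is) [hd is] s \<and> lam = filter_mset (\<lambda>m. 2 \<le> m) (pops s)) \<or>
    (sum_mset lam + size lam \<le> k \<and> even (k - (sum_mset lam + size lam))
      \<and> 2 * card (set is - {0}) + size lam \<le> k + sum_mset lam)"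
proof -
  note walk = adm_tuple_walk[OF adm]
  define w where "w = hd is # rev is"
  define V where "V = set w - {0}"
  define M where "M = cycle_lengths (wprod w) V"
  have w: "w \<noteq> []" "distinct_adj w" "last w = hd w" "length w = Suc k" "set w = set is"
    using walk by (auto simp: w_def)
  have V: "finite V" "wprod w permutes V" using wprod_permutes by (auto simp: V_def)
  have "V \<subseteq> {1..n}" using walk w(5) by (fastforce simp: V_def)
  then have lam: "lam = filter_mset (\<lambda>m. 2 \<le> m) M"
    using cyc_type_eq_filter_cycle_lengths V(2) tuple_prod_eq_wprod[OF walk(1)]
    by (simp add: lam_def M_def w_def)
  have M: "sum_mset M = card V" "size M = card (orbit (wprod w) ` V)"
    using sum_cycle_lengths[OF V] size_cycle_lengths[of "wprod w" V] by (simp_all add: M_def)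
  have "card (orbit (wprod w) x) \<noteq> 0" if "x \<in> V" for x
    using permutes_orbit_subset[OF V(2) that] V(1) orbit_nonempty finite_subset by fastforce
  then have "0 \<notin># M" using V(1) by (force simp: M_def cycle_lengths_def)
  note f = filter_ge2_sum_size[OF this lam]
  have pot: "walk_pot w = card V + size M" using M by (simp add: walk_pot_def V_def)
  show ?thesis
  proof (cases "\<exists>st s. planar_walk w st s")
    case True
    then obtain st s where G: "planar_walk w st s" by blast
    note st = planar_walk_closed_stack[OF G w(3)]
    have "set is \<subseteq> {1..n}"
      using planar_walk_basic[OF G] \<open>V \<subseteq> {1..n}\<close> w(5) by (simp add: V_def)
    then have "lam = filter_mset (\<lambda>m. 2 \<le> m) (pops s)"
      using planar_tuple_cyc_type[OF walk(1)] G st by (simp add: lam_def w_def)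
    then show ?thesis using G st by (auto simp: w_def)
  next
    case False
    \<comment> \<open>The alternative with a set A cannot occur: A would contain the last entry of w
      but not its head, and these agree.\<close>
    then have "walk_pot w + 1 \<le> length w + of_bool (hd w \<noteq> 0)"
      using walk_trichotomy[OF w(1,2)] w(3) by force
    then have "walk_pot w \<le> k + of_bool (hd w \<noteq> 0)" using w(4) by simp
    moreover have "even (walk_pot w + k)"
      using walk_pot_parity[OF w(1,2)] w(3,4) by (auto split: if_splits)
    moreover have "walk_pot w \<noteq> k + 1" using calculation(2) by auto
    ultimately have le: "walk_pot w \<le> k" by (auto simp: of_bool_def split: if_splits)
    \<comment> \<open>A visited fixed point counts twice in the potential, once as a letter and once
      as a cycle.\<close>
    have sum: "walk_pot w = sum_mset lam + size lam + 2 * count M 1" using pot f M by simp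
    have "sum_mset lam + size lam \<le> k" using le sum by simp
    moreover have "even (k - (sum_mset lam + size lam))"
      using \<open>even (walk_pot w + k)\<close> sum le by simp
    moreover have "2 * card (set is - {0}) + size lam \<le> k + sum_mset lam"
    proof -
      have "card (set is - {0}) = sum_mset lam + count M 1" using M f w(5) by (simp add: V_def)
      then show ?thesis using le sum by simp
    qed
    ultimately show ?thesis by blast
  qed
qed

text \<open>With D in the role of the pop lengths, a part 2 of the shifted partition is a completed
  cycle of length one; \<open>Rem\<close> thus undoes the shift and discards fixed points.\<close>

lemma Rem_image_Suc:
  assumes "0 \<notin># D"
  shows "Rem (image_mset Suc D) = filter_mset (\<lambda>m. 2 \<le> m) D"
proof -
  have "Rem (image_mset Suc D) = filter_mset (\<lambda>m. m \<noteq> 1) D"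
    by (simp add: Rem_def filter_mset_image_mset multiset.map_comp o_def)
  also have "\<dots> = filter_mset (\<lambda>m. 2 \<le> m) D"
  proof (rule filter_mset_cong[OF refl])
    fix m assume "m \<in># D"
    then have "m \<noteq> 0" using assms by metis
    then show "m \<noteq> 1 \<longleftrightarrow> 2 \<le> m" by auto
  qed
  finally show ?thesis .
qed

lemma sum_image_Suc: "sum_mset (image_mset Suc D) = sum_mset D + size D"
  by (induction D) auto

lemma image_Suc_in_Ybar:
  assumes "0 \<notin># D"
  shows "image_mset Suc D \<in> Ybar (sum_mset D + size D)"
proof -
  have "1 \<le> x" if "x \<in># D" for x using assms that by (cases x) auto
  then show ?thesis by (auto simp: Ybar_def parts_ge2_def sum_image_Suc)
qed

lemma Ybar_image_Suc:
  assumes "\<mu> \<in> Ybar k"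
  obtains D where "\<mu> = image_mset Suc D" "0 \<notin># D" "sum_mset D + size D = k"
proof -
  define D where "D = image_mset (\<lambda>x. x - 1) \<mu>"
  have ge: "2 \<le> x" if "x \<in># \<mu>" for x using assms that by (auto simp: Ybar_def parts_ge2_def)
  have eq: "\<mu> = image_mset Suc D"
  proof -
    have "image_mset Suc D = image_mset (\<lambda>x. x) \<mu>"
      unfolding D_def multiset.map_comp
    proof (rule image_mset_cong)
      show "(Suc \<circ> (\<lambda>x. x - 1)) x = x" if "x \<in># \<mu>" for x using ge[OF that] by simp
    qed
    then show ?thesis by simp
  qed
  moreover have "0 \<notin># D" using ge by (force simp: D_def)
  moreover have "sum_mset D + size D = k"
    using assms eq sum_image_Suc[of D] by (simp add: Ybar_def)
  ultimately show ?thesis using that by blast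
qed

text \<open>Each one contributes two to the sum plus the size, so the common total fixes the number
  of ones. This is the injectivity of \<open>Rem\<close> on partitions of k.\<close>

lemma filter_ge2_determines:
  fixes D E :: "nat multiset"
  assumes "0 \<notin># D" "0 \<notin># E" "sum_mset D + size D = sum_mset E + size E"
    "filter_mset (\<lambda>m. 2 \<le> m) D = filter_mset (\<lambda>m. 2 \<le> m) E"
  shows "D = E"
proof -
  have "count D 1 = count E 1"
    using filter_ge2_sum_size[OF assms(1) refl] filter_ge2_sum_size[OF assms(2) refl] assms(3,4) by simp
  then show ?thesis using filter_ge2_split[OF assms(1)] filter_ge2_split[OF assms(2)] assms(4) by metis
qed

lemma cyc_type_adm_tuple_Rem:
  assumes "is \<in> adm_tuples n k" "2 \<le> k" "parts_ge2 lam" "cyc_type n (tuple_prod is) = lam"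
  shows "\<exists>\<mu>\<in>Ybar k. lam = Rem \<mu>"
  using adm_tuple_dichotomy[OF assms(1,2)] unfolding assms(4)
proof (elim disjE exE conjE)
  fix s assume G: "planar_walk (hd is # rev is) [hd is] s" "lam = filter_mset (\<lambda>m. 2 \<le> m) (pops s)"
  have "sum_mset (pops s) + size (pops s) = k"
    using closed_planar_walk_pops[OF G(1)] adm_tuple_walk[OF assms(1,2)]
      planar_walk_basic[OF G(1)] by simp
  then show ?thesis
    using G(2) Rem_image_Suc[OF zero_notin_pops] image_Suc_in_Ybar[OF zero_notin_pops] by metis
next
  assume le: "sum_mset lam + size lam \<le> k" and "even (k - (sum_mset lam + size lam))"
  then obtain m where m: "k - (sum_mset lam + size lam) = 2 * m" by blast
  \<comment> \<open>The even deficit is filled with m ones: each adds two to the sum plus the size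
    and is invisible in the cycle type.\<close>
  define D where "D = lam + replicate_mset m 1"
  have ge: "2 \<le> x" if "x \<in># lam" for x using assms(3) that by (auto simp: parts_ge2_def)
  have D0: "0 \<notin># D" using ge[of 0] by (auto simp: D_def)
  have "filter_mset (\<lambda>m. 2 \<le> m) D = lam"
  proof -
    have "filter_mset (\<lambda>m. 2 \<le> m) lam = lam" using ge by (simp add: filter_mset_eq_conv)
    moreover have "filter_mset (\<lambda>m. 2 \<le> m) (replicate_mset m (1::nat)) = {#}"
      by (induction m) auto
    ultimately show ?thesis by (simp add: D_def)
  qed
  moreover have "sum_mset D + size D = k" using m le by (simp add: D_def)
  ultimately show ?thesis using Rem_image_Suc[OF D0] image_Suc_in_Ybar[OF D0] by metis
qed

section \<open>Counting planar tuples by paths\<close>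

text \<open>These are Lukasiewicz paths with the newest step first. The final height h is a natural
  number at every stage, which keeps the path from going below 0.\<close>

inductive luk_path :: "nat list \<Rightarrow> nat \<Rightarrow> bool" where
  Nil: "luk_path [] 0"
| up: "luk_path s h \<Longrightarrow> luk_path (0 # s) (Suc h)"
| down: "luk_path s (Suc d + h) \<Longrightarrow> luk_path (Suc d # s) h"

lemma luk_path_height: "luk_path s h \<Longrightarrow> h + sum_mset (pops s) = count_list s 0"
  by (induction rule: luk_path.induct) auto

lemma planar_walk_luk_path: "planar_walk w st s \<Longrightarrow> luk_path s (length st - 1)"
proof (induction rule: planar_walk.induct)
  case (push w st s y)
  then obtain h where "length st = Suc h" using planar_walk_basic[OF push.hyps(1)] by (cases st) auto
  then show ?case using luk_path.up[OF push.IH] by simp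
next
  case (pop w x u y st s)
  then show ?case using luk_path.down[of s "length u" "length st"] by simp
qed (simp add: luk_path.Nil)

section \<open>Walks belonging to a given path\<close>

inductive_cases planar_walk_singleE [consumes 1]: "planar_walk [v] st s"
inductive_cases planar_walk_ConsE [consumes 1]: "planar_walk (y # w) st s"
inductive_cases planar_walk_pushE [consumes 1]: "planar_walk w st (0 # s)"
inductive_cases planar_walk_popE [consumes 1]: "planar_walk w st (Suc d # s)"

lemma planar_walk_Nil: "\<not> planar_walk [] st s"
  using planar_walk_basic by blast

text \<open>A new letter can only be pushed and an old one only be popped to; its position in a
  stack without repetitions fixes the length of the pop.\<close>

lemma planar_walk_determ:
  "planar_walk w st s \<Longrightarrow> planar_walk w st' s' \<Longrightarrow> st = st' \<and> s = s'"
proof (induction arbitrary: st' s' rule: planar_walk.induct)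
  case (start v)
  then show ?case by (auto elim: planar_walk_singleE simp: planar_walk_Nil)
next
  case (push w st s y)
  from push.prems show ?case
  proof (cases rule: planar_walk_ConsE)
    case 1
    then show ?thesis using push.hyps planar_walk_Nil 1 by auto
  next
    case (2 st1 s1)
    then show ?thesis using push.IH by auto
  next
    case (3 x1 u1 st1 s1)
    then have "y \<in> set w" using planar_walk_basic[OF 3(3)] by auto
    then show ?thesis using push.hyps by simp
  qed
next
  case (pop w x u y t s)
  from pop.prems show ?case
  proof (cases rule: planar_walk_ConsE)
    case 1
    then show ?thesis using pop.hyps planar_walk_Nil 1 by auto
  next
    case (2 st1 s1)
    then have "y \<in> set w" using planar_walk_basic[OF pop.hyps] by auto
    then show ?thesis using 2 by simp
  next
    case (3 x1 u1 st1 s1)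
    note eq = pop.IH[OF 3(3)]
    have "distinct (x # u @ y # t)" using planar_walk_basic[OF pop.hyps] by blast
    then have "y \<notin> set u" "y \<notin> set t" by auto
    moreover have "u @ y # t = u1 @ y # st1" using eq by simp
    ultimately have "u = u1 \<and> t = st1"
      by (rule iffD1[OF append_Cons_eq_iff])
    then show ?thesis using eq 3 by simp
  qed
qed

definition planar_walks :: "nat \<Rightarrow> nat list \<Rightarrow> nat list set" where
  "planar_walks n s = {w. set w \<subseteq> {1..n} \<and> (\<exists>st. planar_walk w st s)}"

lemma finite_planar_walks: "finite (planar_walks n s)"
proof (rule finite_subset)
  show "planar_walks n s \<subseteq> {w. set w \<subseteq> {1..n} \<and> length w = Suc (length s)}"
    using planar_walk_basic by (auto simp: planar_walks_def)
qed (rule finite_lists_length_eq, simp)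

lemma card_planar_walks:
  assumes "luk_path s h"
  shows "card (planar_walks n s) = (\<Prod>i\<le>count_list s 0. n - i)"
  using assms
proof induction
  case Nil
  have "planar_walks n [] = (\<lambda>v. [v]) ` {1..n}"
  proof (intro equalityI subsetI)
    fix w assume "w \<in> planar_walks n []"
    then show "w \<in> (\<lambda>v. [v]) ` {1..n}"
      using planar_walk_basic by (fastforce simp: planar_walks_def length_Suc_conv)
  next
    fix w assume "w \<in> (\<lambda>v. [v]) ` {1..n}"
    then obtain v where "w = [v]" "v \<in> {1..n}" by blast
    then show "w \<in> planar_walks n []"
      using planar_walk.start[of v] by (auto simp: planar_walks_def)
  qed
  then show ?case by (simp add: card_image inj_on_def)
next
  case (up s h)
  have eq: "planar_walks n (0 # s) = (\<lambda>(w, y). y # w) ` (SIGMA w:planar_walks n s. {1..n} - set w)"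
  proof (intro equalityI subsetI)
    fix w' assume "w' \<in> planar_walks n (0 # s)"
    then obtain st where "set w' \<subseteq> {1..n}" "planar_walk w' st (0 # s)" by (auto simp: planar_walks_def)
    from this(2,1) show "w' \<in> (\<lambda>(w, y). y # w) ` (SIGMA w:planar_walks n s. {1..n} - set w)"
      by (cases rule: planar_walk_pushE) (auto simp: planar_walks_def image_iff)
  next
    fix w' assume "w' \<in> (\<lambda>(w, y). y # w) ` (SIGMA w:planar_walks n s. {1..n} - set w)"
    then obtain w y st where "w' = y # w" "set w \<subseteq> {1..n}" "planar_walk w st s" "y \<in> {1..n} - set w"
      by (auto simp: planar_walks_def)
    then show "w' \<in> planar_walks n (0 # s)"
      using planar_walk.push[of w st s y] by (auto simp: planar_walks_def)
  qed
  have "card (planar_walks n (0 # s)) = card (SIGMA w:planar_walks n s. {1..n} - set w)"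
    unfolding eq by (rule card_image) (auto simp: inj_on_def)
  also have "\<dots> = (\<Sum>w\<in>planar_walks n s. card ({1..n} - set w))"
    by (intro card_SigmaI finite_planar_walks) auto
  also have "\<dots> = (\<Sum>w\<in>planar_walks n s. n - Suc (count_list s 0))"
  proof (rule sum.cong[OF refl])
    fix w assume "w \<in> planar_walks n s"
    then obtain st where w: "set w \<subseteq> {1..n}" "planar_walk w st s" by (auto simp: planar_walks_def)
    have "card (set w) = Suc (count_list s 0)"
      using planar_walk_basic[OF w(2)] size_pops[of s] by linarith
    then show "card ({1..n} - set w) = n - Suc (count_list s 0)"
      using w(1) by (simp add: card_Diff_subset)
  qed
  finally show ?case using up.IH by (simp add: mult.commute)
next
  case (down s d h)
  \<comment> \<open>Forgetting the last letter loses nothing, since the stack and the pop length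
    determine it.\<close>
  have "bij_betw tl (planar_walks n (Suc d # s)) (planar_walks n s)"
    unfolding bij_betw_def
  proof
    show "inj_on tl (planar_walks n (Suc d # s))"
    proof (rule inj_onI)
      fix w1 w2 assume w: "w1 \<in> planar_walks n (Suc d # s)" "w2 \<in> planar_walks n (Suc d # s)" "tl w1 = tl w2"
      obtain st1 where "planar_walk w1 st1 (Suc d # s)" using w(1) by (auto simp: planar_walks_def)
      then obtain v1 x1 u1 y1 t1 where 1: "w1 = y1 # v1" "d = length u1" "planar_walk v1 (x1 # u1 @ y1 # t1) s"
        by (cases rule: planar_walk_popE) auto
      obtain st2 where "planar_walk w2 st2 (Suc d # s)" using w(2) by (auto simp: planar_walks_def)
      then obtain v2 x2 u2 y2 t2 where 2: "w2 = y2 # v2" "d = length u2" "planar_walk v2 (x2 # u2 @ y2 # t2) s"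
        by (cases rule: planar_walk_popE) auto
      have "x1 # u1 @ y1 # t1 = x2 # u2 @ y2 # t2"
        using planar_walk_determ[of v1 "x1 # u1 @ y1 # t1" s "x2 # u2 @ y2 # t2" s] 1 2 w(3) by simp
      then show "w1 = w2" using 1 2 w(3) by simp
    qed
    show "tl ` planar_walks n (Suc d # s) = planar_walks n s"
    proof (intro equalityI subsetI)
      fix w assume "w \<in> tl ` planar_walks n (Suc d # s)"
      then obtain w' st where w': "w = tl w'" "set w' \<subseteq> {1..n}" "planar_walk w' st (Suc d # s)"
        by (auto simp: planar_walks_def)
      from w'(3,1,2) show "w \<in> planar_walks n s"
        by (cases rule: planar_walk_popE) (auto simp: planar_walks_def)
    next
      fix w assume "w \<in> planar_walks n s"
      then obtain st where w: "set w \<subseteq> {1..n}" "planar_walk w st s" by (auto simp: planar_walks_def)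
      \<comment> \<open>The height guarantees that a letter remains below the popped ones; after x
        and d further letters are removed, it is \<open>st' ! d\<close>.\<close>
      have "length st = Suc (Suc d + h)"
        using planar_walk_basic[OF w(2)] luk_path_height[OF down.hyps] size_pops[of s] by linarith
      then obtain x st' where st: "st = x # st'" "length st' = Suc d + h" by (cases st) auto
      then have "st' = take d st' @ st' ! d # drop (Suc d) st'"
        by (simp add: id_take_nth_drop)
      then have walk: "planar_walk w (x # take d st' @ st' ! d # drop (Suc d) st') s"
        using w(2) st by simp
      have "length (take d st') = d" using st by simp
      then have "planar_walk (st' ! d # w) (st' ! d # drop (Suc d) st') (Suc d # s)"
        using planar_walk.pop[OF walk] by simp
      moreover have "st' ! d \<in> set w" using planar_walk_basic[OF w(2)] st by auto
      ultimately have "st' ! d # w \<in> planar_walks n (Suc d # s)"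
        using w(1) by (auto simp: planar_walks_def)
      then show "w \<in> tl ` planar_walks n (Suc d # s)" by force
    qed
  qed
  then show ?case using down.IH by (simp add: bij_betw_same_card)
qed

definition luk_paths :: "nat multiset \<Rightarrow> nat list set" where
  "luk_paths D = {s. luk_path s 0 \<and> pops s = D}"

lemma luk_paths_props:
  assumes "s \<in> luk_paths D"
  shows "count_list s 0 = sum_mset D" "length s = sum_mset D + size D"
  using assms luk_path_height[of s 0] size_pops[of s] by (auto simp: luk_paths_def)

lemma finite_luk_paths: "finite (luk_paths D)"
proof (rule finite_subset)
  show "luk_paths D \<subseteq> {s. set s \<subseteq> insert 0 (set_mset D) \<and> length s = sum_mset D + size D}"
    using luk_paths_props(2) by (auto simp: luk_paths_def pops_def)
qed (rule finite_lists_length_eq, simp)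

definition planar_tuples :: "nat \<Rightarrow> nat multiset \<Rightarrow> nat list set" where
  "planar_tuples n D = {is. set is \<subseteq> {1..n} \<and>
     (\<exists>s. planar_walk (hd is # rev is) [hd is] s \<and> pops s = D)}"

text \<open>Repeating the first letter turns tuples injectively into closed walks, which are then
  counted path by path. The assumption on D excludes the empty tuple, whose head is
  unspecified.\<close>

lemma card_planar_tuples:
  assumes "0 < size D"
  shows "card (planar_tuples n D) = card (luk_paths D) * (\<Prod>i\<le>sum_mset D. n - i)"
proof -
  define T where "T = (\<lambda>is. hd is # rev is) ` planar_tuples n D"
  have T: "T = (\<Union>s\<in>luk_paths D. planar_walks n s)"
  proof (intro equalityI subsetI)
    fix w assume "w \<in> T"
    then obtain "is" s where i: "w = hd is # rev is" "set is \<subseteq> {1..n}" "planar_walk w [hd is] s" "pops s = D"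
      by (auto simp: T_def planar_tuples_def)
    have "is \<noteq> []"
      using planar_walk_basic[OF i(3)] i(1,4) assms by (auto simp: pops_def)
    then have "hd is \<in> {1..n}" using i(2) hd_in_set by blast
    then have "set w \<subseteq> {1..n}" using i(1,2) by simp
    then show "w \<in> (\<Union>s\<in>luk_paths D. planar_walks n s)"
      using i(3,4) planar_walk_luk_path[OF i(3)] by (auto simp: luk_paths_def planar_walks_def)
  next
    fix w assume "w \<in> (\<Union>s\<in>luk_paths D. planar_walks n s)"
    then obtain s st where s: "s \<in> luk_paths D" "set w \<subseteq> {1..n}" "planar_walk w st s"
      by (auto simp: planar_walks_def)
    note b = planar_walk_basic[OF s(3)]
    have "length st = 1" using b luk_paths_props(1)[OF s(1)] s(1) size_pops[of s]
      by (auto simp: luk_paths_def)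
    then obtain x where x: "st = [x]" by (auto simp: length_Suc_conv)
    then have wx: "hd w = x" "last w = x" using b by auto
    have "length s \<noteq> 0" using luk_paths_props(2)[OF s(1)] assms by linarith
    then have "length (tl w) \<noteq> 0" using b by simp
    then obtain t where t: "w = x # t" "t \<noteq> []" using wx(1) by (cases w) auto
    have "hd (rev t) = x" using t wx(2) by (simp add: hd_rev)
    then have "w = hd (rev t) # rev (rev t)" using t by simp
    moreover from this have "rev t \<in> planar_tuples n D"
      using s t x \<open>hd (rev t) = x\<close> by (auto simp: planar_tuples_def luk_paths_def)
    ultimately show "w \<in> T" unfolding T_def by (rule image_eqI)
  qed
  have "card (planar_tuples n D) = card T"
    unfolding T_def by (rule card_image[symmetric]) (auto simp: inj_on_def)
  also have "\<dots> = (\<Sum>s\<in>luk_paths D. card (planar_walks n s))"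
    unfolding T
  proof (intro card_UN_disjoint finite_luk_paths ballI impI)
    fix s s' :: "nat list" assume "s \<noteq> s'"
    then show "planar_walks n s \<inter> planar_walks n s' = {}"
      using planar_walk_determ by (auto simp: planar_walks_def)
  qed (rule finite_planar_walks)
  also have "\<dots> = (\<Sum>s\<in>luk_paths D. \<Prod>i\<le>sum_mset D. n - i)"
    using card_planar_walks luk_paths_props(1) by (intro sum.cong) (auto simp: luk_paths_def)
  finally show ?thesis by simp
qed

section \<open>Paths and noncrossing partitions\<close>

text \<open>The initial letter of a walk has no counterpart here, so the length of the stack of open
  positions is exactly the height of the path.\<close>

inductive stack_run :: "nat list \<Rightarrow> nat list \<Rightarrow> nat set set \<Rightarrow> bool" where
  Nil: "stack_run [] [] {}"
| push: "stack_run s st P \<Longrightarrow> stack_run (0 # s) (Suc (length s) # st) P"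
| pop: "stack_run s (u @ st) P \<Longrightarrow> u \<noteq> [] \<Longrightarrow>
    stack_run (length u # s) st (insert (insert (Suc (length s)) (set u)) P)"

inductive_cases stack_run_NilE [consumes 1]: "stack_run [] st P"
inductive_cases stack_run_ConsE [consumes 1]: "stack_run (d # s) st P"

text \<open>Position j closes the block with maximum j. There is at most one such block, and the sum over
  these blocks is 0, i.e. a push, if there is none.\<close>

fun block_path :: "nat set set \<Rightarrow> nat \<Rightarrow> nat list" where
  "block_path P 0 = []"
| "block_path P (Suc j) = (\<Sum>B\<in>{B \<in> P. Max B = Suc j}. card B - 1) # block_path P j"

lemma length_block_path [simp]: "length (block_path P j) = j"
  by (induction j) auto

lemma block_path_insert:
  assumes "j < Max B"
  shows "block_path (insert B P) j = block_path P j"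
  using assms
proof (induction j)
  case (Suc j)
  then have "{C \<in> insert B P. Max C = Suc j} = {C \<in> P. Max C = Suc j}" by auto
  then show ?case using Suc by simp
qed simp

lemma stack_run_determ:
  "stack_run s st P \<Longrightarrow> stack_run s st' P' \<Longrightarrow> st = st' \<and> P = P'"
proof (induction arbitrary: st' P' rule: stack_run.induct)
  case Nil
  then show ?case by (auto elim: stack_run_NilE)
next
  case (push s st P)
  from push.prems push.IH show ?case by (cases rule: stack_run_ConsE) auto
next
  case (pop s u st P)
  from pop.prems show ?case
  proof (cases rule: stack_run_ConsE)
    case (1 st1)
    then show ?thesis using pop.hyps by simp
  next
    case (2 u1 P1)
    have "u @ st = u1 @ st'" "P = P1" using pop.IH[OF 2(3)] by auto
    then have "u = u1" "st = st'" using 2(1) by auto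
    then show ?thesis using 2 \<open>P = P1\<close> by simp
  qed
qed

text \<open>The last clause makes noncrossing inductive: no open position lies inside a finished
  block, and the next block consists of open positions and a new maximum.\<close>

lemma stack_run_partition:
  assumes "stack_run s st P"
  shows "sorted_wrt (>) st" "partition_on ({1..length s} - set st) P" "set st \<subseteq> {1..length s}"
    "noncrossing P" "\<And>B a c x. B \<in> P \<Longrightarrow> a \<in> B \<Longrightarrow> c \<in> B \<Longrightarrow> x \<in> set st \<Longrightarrow> \<not> (a < x \<and> x < c)"
proof -
  have "sorted_wrt (>) st \<and> partition_on ({1..length s} - set st) P \<and> set st \<subseteq> {1..length s}
    \<and> noncrossing P \<and> (\<forall>B\<in>P. \<forall>a\<in>B. \<forall>c\<in>B. \<forall>x\<in>set st. \<not> (a < x \<and> x < c))"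
    using assms
  proof induction
    case Nil
    show ?case by (simp add: partition_on_empty noncrossing_def)
  next
    case (push s st P)
    then have IH: "sorted_wrt (>) st" "partition_on ({1..length s} - set st) P" "set st \<subseteq> {1..length s}"
      "noncrossing P" "\<forall>B\<in>P. \<forall>a\<in>B. \<forall>c\<in>B. \<forall>x\<in>set st. \<not> (a < x \<and> x < c)" by blast+
    have "{1..length (0 # s)} - set (Suc (length s) # st) = {1..length s} - set st" by auto
    moreover have "B \<subseteq> {1..length s}" if "B \<in> P" for B
      using partition_onD1[OF IH(2)] that by blast
    moreover have "\<forall>B\<in>P. \<forall>a\<in>B. \<forall>c\<in>B. \<forall>x\<in>set (Suc (length s) # st). \<not> (a < x \<and> x < c)"
      using IH(5) calculation(2) by fastforce
    ultimately show ?case using IH by fastforce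
  next
    case (pop s u st P)
    define j where "j = length s"
    define B where "B = insert (Suc j) (set u)"
    from pop.IH have IH: "sorted_wrt (>) (u @ st)" "partition_on ({1..j} - set (u @ st)) P"
      "set (u @ st) \<subseteq> {1..j}" "noncrossing P"
      "\<And>B a c x. B \<in> P \<Longrightarrow> a \<in> B \<Longrightarrow> c \<in> B \<Longrightarrow> x \<in> set (u @ st) \<Longrightarrow> \<not> (a < x \<and> x < c)"
      unfolding j_def by blast+
    have sub: "C \<subseteq> {1..j} - set (u @ st)" if "C \<in> P" for C
      using partition_onD1[OF IH(2)] that by blast
    have gt: "y < x" if "x \<in> set u" "y \<in> set st" for x y
      using IH(1) that by (auto simp: sorted_wrt_append)
    have "sorted_wrt (>) st" using IH(1) by (simp add: sorted_wrt_append)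
    moreover have "partition_on ({1..Suc j} - set st) (insert B P)"
    proof -
      have "set u \<inter> set st = {}" using gt by fastforce
      then have "{1..Suc j} - set st = ({1..j} - set (u @ st)) \<union> B"
        using IH(3) by (auto simp: B_def)
      moreover have "({1..j} - set (u @ st)) \<inter> B = {}" by (auto simp: B_def)
      moreover have "B \<noteq> {}" by (simp add: B_def)
      ultimately show ?thesis
        using IH(2) unfolding partition_on_def by (auto simp: disjoint_def)
    qed
    moreover have "set st \<subseteq> {1..Suc j}" using IH(3) by auto
    moreover have "noncrossing (insert B P)"
    proof -
      have 1: False
        if C: "C \<in> P" "a < b" "b < c" "c < d" "a \<in> B" "c \<in> B" "b \<in> C" "d \<in> C" for C a b c d
      proof -
        have "d \<le> j" using sub C by fastforce
        then have "c \<in> set u" using C by (auto simp: B_def)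
        then show False using IH(5)[of C b d c] C by auto
      qed
      have 2: False
        if C: "C \<in> P" "a < b" "b < c" "c < d" "a \<in> C" "c \<in> C" "b \<in> B" "d \<in> B" for C a b c d
      proof -
        have "c \<le> j" using sub C by fastforce
        then have "b \<in> set u" using C by (auto simp: B_def)
        then show False using IH(5)[of C a c b] C by auto
      qed
      show ?thesis
        using IH(4) 1 2 unfolding noncrossing_def by (metis insert_iff)
    qed
    moreover have "\<not> (a < x \<and> x < c)" if "a \<in> C" "c \<in> C" "x \<in> set st" "C \<in> insert B P" for C a c x
    proof (cases "C = B")
      case True
      have "x \<le> j" using that IH(3) by auto
      then have "a \<in> set u" if "a < x" using \<open>a \<in> C\<close> that True by (auto simp: B_def)
      then show ?thesis using gt that by fastforce
    next
      case False
      then show ?thesis using IH(5)[of C a c x] that by auto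
    qed
    ultimately show ?case unfolding B_def j_def by auto
  qed
  then show "sorted_wrt (>) st" "partition_on ({1..length s} - set st) P" "set st \<subseteq> {1..length s}"
    "noncrossing P" "\<And>B a c x. B \<in> P \<Longrightarrow> a \<in> B \<Longrightarrow> c \<in> B \<Longrightarrow> x \<in> set st \<Longrightarrow> \<not> (a < x \<and> x < c)"
    by blast+
qed

text \<open>The block closed by a pop is the only one whose maximum is the current position, so each
  step can be recovered from the partition.\<close>

lemma stack_run_block_path:
  assumes "stack_run s st P"
  shows "block_path P (length s) = s \<and> image_mset card (mset_set P) = image_mset Suc (pops s)
    \<and> luk_path s (length st)"
  using assms
proof induction
  case Nil
  show ?case by (simp add: luk_path.Nil)
next
  case (push s st P)
  note inv = stack_run_partition[OF push.hyps]
  have "Max C \<noteq> Suc (length s)" if "C \<in> P" for C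
  proof -
    have "C \<subseteq> {1..length s}" "C \<noteq> {}"
      using partition_onD1[OF inv(2)] partition_onD3[OF inv(2)] that by auto
    then show ?thesis using Max_in[of C] finite_subset[of C "{1..length s}"] by fastforce
  qed
  then have "{C \<in> P. Max C = Suc (length s)} = {}" by blast
  then show ?case using push.IH by (simp add: luk_path.up del: Collect_empty_eq)
next
  case (pop s u st P)
  note inv = stack_run_partition[OF pop.hyps(1)]
  define j where "j = length s"
  define B where "B = insert (Suc j) (set u)"
  have "sorted_wrt (<) (rev (u @ st))" using inv(1) by (simp only: sorted_wrt_rev)
  then have "distinct (rev (u @ st))" by (simp only: strict_sorted_iff)
  then have u: "set u \<subseteq> {1..j}" "distinct u"
    using inv(3) by (auto simp: j_def)
  then have B: "Max B = Suc j" "card B = Suc (length u)"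
    unfolding B_def by (auto intro!: Max_eqI simp: distinct_card card_insert_if)
  have PMax: "Max C \<noteq> Suc j" if "C \<in> P" for C
  proof -
    have "C \<subseteq> {1..j}" "C \<noteq> {}"
      using partition_onD1[OF inv(2)] partition_onD3[OF inv(2)] that by (auto simp: j_def)
    then show ?thesis using Max_in[of C] finite_subset[of C "{1..j}"] by fastforce
  qed
  then have "B \<notin> P" using B by blast
  have "finite P" using finite_elements[OF _ inv(2)] by simp
  have "{C \<in> insert B P. Max C = Suc j} = {B}" using PMax B by blast
  moreover have "block_path (insert B P) j = s"
    using block_path_insert[of j B P] B pop.IH by (simp add: j_def)
  ultimately have "block_path (insert B P) (length (length u # s)) = length u # s"
    using B by (simp add: j_def)
  moreover obtain d where d: "length u = Suc d" using pop.hyps(2) by (cases u) auto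
  moreover have "image_mset card (mset_set (insert B P)) = image_mset Suc (pops (length u # s))"
    using \<open>B \<notin> P\<close> \<open>finite P\<close> pop.IH B d by simp
  moreover have "luk_path (length u # s) (length st)"
    using luk_path.down[of s d "length st"] pop.IH d by simp
  ultimately show ?case unfolding B_def j_def by blast
qed

section \<open>Runs produced by paths and by noncrossing partitions\<close>

lemma luk_path_stack_run:
  "luk_path s h \<Longrightarrow> \<exists>st P. stack_run s st P \<and> length st = h"
proof (induction rule: luk_path.induct)
  case Nil
  show ?case using stack_run.Nil by force
next
  case (up s h)
  then show ?case using stack_run.push by fastforce
next
  case (down s d h)
  then obtain st P where st: "stack_run s st P" "length st = Suc d + h" by blast
  have "stack_run s (take (Suc d) st @ drop (Suc d) st) P" "take (Suc d) st \<noteq> []"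
    using st by auto
  from stack_run.pop[OF this] st(2) show ?case by (intro exI conjI) auto
qed

text \<open>In a decreasing list an upward closed property selects an initial segment. It is used to
  see that the elements of a closing block lie on top of the stack.\<close>

lemma filter_split_upward:
  assumes "sorted_wrt (>) (xs :: 'a :: linorder list)"
    "\<And>x y. x \<in> set xs \<Longrightarrow> y \<in> set xs \<Longrightarrow> Q x \<Longrightarrow> x < y \<Longrightarrow> Q y"
  shows "filter Q xs @ filter (\<lambda>x. \<not> Q x) xs = xs"
  using assms
proof (induction xs)
  case (Cons z xs)
  have IH: "filter Q xs @ filter (\<lambda>x. \<not> Q x) xs = xs"
  proof (rule Cons.IH)
    show "sorted_wrt (>) xs" using Cons.prems(1) by simp
    show "Q y" if "x \<in> set xs" "y \<in> set xs" "Q x" "x < y" for x y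
      using Cons.prems(2)[of x y] that by simp
  qed
  show ?case
  proof (cases "Q z")
    case False
    then have "\<not> Q x" if "x \<in> set xs" for x
      using Cons.prems(2)[of x z] Cons.prems(1) that by auto
    then have "filter Q xs = []" "filter (\<lambda>x. \<not> Q x) xs = xs" by auto
    then show ?thesis using False by simp
  qed (use IH in simp)
qed simp

lemma noncrossingD:
  assumes "noncrossing P" "B \<in> P" "C \<in> P" "B \<noteq> C"
    "a < b" "b < c" "c < d" "a \<in> B" "c \<in> B" "b \<in> C" "d \<in> C"
  shows False
  using assms unfolding noncrossing_def by metis

text \<open>At time j the stack holds the positions up to j whose blocks are unfinished. Noncrossing
  allows a closing block to be popped from the top, and blocks of size at least two ensure that this
  pop is not read as a push.\<close>

lemma noncrossing_stack_run:
  assumes P: "partition_on {1..k} P" "noncrossing P" "\<And>B. B \<in> P \<Longrightarrow> 2 \<le> card B" and "j \<le> k"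
  shows "stack_run (block_path P j) (filter (\<lambda>x. \<exists>B\<in>P. x \<in> B \<and> j < Max B) (rev [1..<Suc j]))
    {B \<in> P. Max B \<le> j}"
  using \<open>j \<le> k\<close>
proof (induction j)
  have sub: "B \<subseteq> {1..k}" "finite B" "B \<noteq> {}" if "B \<in> P" for B
  proof -
    show "B \<subseteq> {1..k}" "B \<noteq> {}"
      using partition_onD1[OF P(1)] partition_onD3[OF P(1)] that by auto
    then show "finite B" using finite_subset[of B "{1..k}"] by blast
  qed
  have same: "B = C" if "B \<in> P" "C \<in> P" "x \<in> B" "x \<in> C" for B C x
    using partition_onD2[OF P(1)] that by (auto simp: disjoint_def)
  {
    case 0
    have "Max B \<noteq> 0" if "B \<in> P" for B using sub[OF that] Max_in[of B] by fastforce
    then have emp: "{B \<in> P. Max B \<le> 0} = {}" by auto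
    show ?case unfolding emp using stack_run.Nil by simp
  next
    case (Suc j)
    define st where "st = filter (\<lambda>x. \<exists>B\<in>P. x \<in> B \<and> j < Max B) (rev [1..<Suc j])"
    define st' where "st' = filter (\<lambda>x. \<exists>B\<in>P. x \<in> B \<and> Suc j < Max B) (rev [1..<Suc (Suc j)])"
    have IH: "stack_run (block_path P j) st {B \<in> P. Max B \<le> j}"
      using Suc by (simp add: st_def)
    have "Suc j \<in> \<Union>P" using partition_onD1[OF P(1)] Suc.prems by auto
    then obtain B where B: "B \<in> P" "Suc j \<in> B" by blast
    have st_mem: "x \<in> set st \<longleftrightarrow> 1 \<le> x \<and> x \<le> j \<and> (\<exists>C\<in>P. x \<in> C \<and> j < Max C)" for x
      by (auto simp: st_def)
    have MaxB: "Suc j \<le> Max B" using B sub[OF B(1)] by simp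
    have onlyB: "C = B" if "C \<in> P" "Max C = Suc j" for C
      using same[OF that(1) B(1), of "Suc j"] B(2) sub[OF that(1)] Max_in[of C] that(2) by simp
    have upt: "rev [1..<Suc (Suc j)] = Suc j # rev [1..<Suc j]" by simp
    have "stack_run (block_path P (Suc j)) st' {B \<in> P. Max B \<le> Suc j}"
    proof (cases "Max B = Suc j")
      case True
      define u where "u = filter (\<lambda>x. x \<in> B) st"
      have st'_eq: "st' = filter (\<lambda>x. x \<notin> B) st"
      proof -
        have "\<not> (\<exists>C\<in>P. Suc j \<in> C \<and> Suc j < Max C)"
          using same[OF _ B(1) _ B(2)] True by (metis less_irrefl)
        then have "st' = filter (\<lambda>x. \<exists>C\<in>P. x \<in> C \<and> Suc j < Max C) (rev [1..<Suc j])"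
          by (simp only: st'_def upt filter.simps if_False)
        also have "\<dots> = filter (\<lambda>x. (\<exists>C\<in>P. x \<in> C \<and> j < Max C) \<and> x \<notin> B) (rev [1..<Suc j])"
        proof (rule filter_cong[OF refl])
          fix x
          show "(\<exists>C\<in>P. x \<in> C \<and> Suc j < Max C) \<longleftrightarrow> (\<exists>C\<in>P. x \<in> C \<and> j < Max C) \<and> x \<notin> B"
            using same[OF B(1)] True onlyB by (metis Suc_lessD Suc_lessI less_irrefl)
        qed
        finally show ?thesis by (simp only: st_def filter_filter)
      qed
      have "sorted_wrt (>) st"
        unfolding st_def by (intro sorted_wrt_filter) (simp add: sorted_wrt_rev del: upt_Suc)
      then have "u @ st' = st"
        unfolding st'_eq u_def
      proof (rule filter_split_upward)
        fix x y assume xy: "x \<in> set st" "y \<in> set st" "x \<in> B" "x < y"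
        obtain C where C: "C \<in> P" "y \<in> C" "j < Max C" using xy by (auto simp: st_mem)
        \<comment> \<open>Otherwise y lies in another block C that ends after \<open>Suc j\<close>;
          then x and \<open>Suc j\<close> in B would cross y and \<open>Max C\<close> in C.\<close>
        show "y \<in> B"
        proof (rule ccontr)
          assume "y \<notin> B"
          then have "C \<noteq> B" using C by blast
          then have "Suc j < Max C" using C onlyB by (metis Suc_lessI)
          moreover have "Max C \<in> C" using sub[OF C(1)] by simp
          moreover have "y < Suc j" using xy by (simp add: st_mem)
          ultimately show False
            using noncrossingD[OF P(2) B(1) C(1), of x y "Suc j" "Max C"] B C \<open>C \<noteq> B\<close> xy by simp
        qed
      qed
      have set_u: "insert (Suc j) (set u) = B"
      proof -
        have "x \<in> set u" if "x \<in> B" "x \<noteq> Suc j" for x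
        proof -
          have "x \<le> Suc j" using that sub[OF B(1)] True by (metis Max_ge)
          moreover have "1 \<le> x" using that sub[OF B(1)] by auto
          ultimately show ?thesis using that B True by (auto simp: u_def st_mem)
        qed
        then show ?thesis using B by (auto simp: u_def)
      qed
      have "distinct u" by (simp add: u_def st_def del: upt_Suc)
      moreover have "Suc j \<notin> set u" by (auto simp: u_def st_mem)
      ultimately have card_B: "card B = Suc (length u)"
        using set_u by (metis card_insert_disjoint distinct_card finite_set)
      then have "u \<noteq> []" using P(3)[OF B(1)] by auto
      have "{C \<in> P. Max C = Suc j} = {B}" using onlyB B True by blast
      then have path: "block_path P (Suc j) = length u # block_path P j" using card_B by simp
      have "stack_run (length u # block_path P j) st'
          (insert (insert (Suc (length (block_path P j))) (set u)) {B \<in> P. Max B \<le> j})"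
        using IH \<open>u @ st' = st\<close> \<open>u \<noteq> []\<close> by (intro stack_run.pop) simp_all
      moreover have "{C \<in> P. Max C \<le> Suc j} = insert B {C \<in> P. Max C \<le> j}"
      proof -
        have "Max C \<le> Suc j \<longleftrightarrow> C = B \<or> Max C \<le> j" if "C \<in> P" for C
          using onlyB[OF that] True by (metis le_Suc_eq order.refl)
        then show ?thesis using B(1) by blast
      qed
      ultimately show ?thesis using path set_u by simp
    next
      case False
      then have no: "Max C \<noteq> Suc j" if "C \<in> P" for C using onlyB that by blast
      then have emp: "{C \<in> P. Max C = Suc j} = {}" by blast
      have path: "block_path P (Suc j) = 0 # block_path P j"
        by (simp only: block_path.simps emp sum.empty)
      have "{C \<in> P. Max C \<le> Suc j} = {C \<in> P. Max C \<le> j}"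
        using no by (auto simp: le_Suc_eq)
      moreover have "st' = Suc j # st"
      proof -
        have iff: "Suc j < Max C \<longleftrightarrow> j < Max C" if "C \<in> P" for C using no[OF that] by linarith
        then have "(\<lambda>x. \<exists>C\<in>P. x \<in> C \<and> Suc j < Max C) = (\<lambda>x. \<exists>C\<in>P. x \<in> C \<and> j < Max C)"
          by (intro ext bex_cong) auto
        moreover have "\<exists>C\<in>P. Suc j \<in> C \<and> j < Max C" using B MaxB by auto
        ultimately show ?thesis unfolding st'_def st_def upt by simp
      qed
      ultimately show ?thesis using stack_run.push[OF IH] path by simp
    qed
    then show ?case by (simp only: st'_def)
  }
qed

text \<open>At time k every block is finished and the stack is empty. Hence
  \<open>block_path\<close> turns a partition into a path, and the run of that path rebuilds the
  same partition.\<close>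

lemma card_NC_eq_card_luk_paths:
  assumes "0 \<notin># D"
  shows "card (NC (image_mset Suc D)) = card (luk_paths D)"
proof -
  define k where "k = sum_mset D + size D"
  have sum: "sum_mset (image_mset Suc D) = k" by (simp add: k_def sum_image_Suc)
  have run: "stack_run (block_path P k) [] P" if "P \<in> NC (image_mset Suc D)" for P
  proof -
    have P: "partition_on {1..k} P" "noncrossing P" "image_mset card (mset_set P) = image_mset Suc D"
      using that sum by (auto simp: NC_def)
    have fin: "finite P" using finite_elements[OF _ P(1)] by simp
    have "2 \<le> card B" if "B \<in> P" for B
    proof -
      have "card B \<in># image_mset Suc D" unfolding P(3)[symmetric] using that fin by simp
      then obtain d where "d \<in># D" "card B = Suc d" by auto
      moreover have "d \<noteq> 0" using calculation(1) assms by metis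
      ultimately show ?thesis by simp
    qed
    from noncrossing_stack_run[OF P(1,2) this order.refl]
    have "stack_run (block_path P k) (filter (\<lambda>x. \<exists>B\<in>P. x \<in> B \<and> k < Max B) (rev [1..<Suc k]))
        {B \<in> P. Max B \<le> k}" .
    moreover have "Max B \<le> k" if "B \<in> P" for B
    proof -
      have "B \<subseteq> {1..k}" "B \<noteq> {}"
        using partition_onD1[OF P(1)] partition_onD3[OF P(1)] that by auto
      then show ?thesis using Max_in[of B] finite_subset[of B "{1..k}"] by fastforce
    qed
    then have "{B \<in> P. Max B \<le> k} = P" "filter (\<lambda>x. \<exists>B\<in>P. x \<in> B \<and> k < Max B) (rev [1..<Suc k]) = []"
      by (auto simp: filter_empty_conv not_less)
    ultimately show ?thesis by simp
  qed
  have "bij_betw (\<lambda>P. block_path P k) (NC (image_mset Suc D)) (luk_paths D)"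
  proof (rule bij_betw_imageI)
    show "inj_on (\<lambda>P. block_path P k) (NC (image_mset Suc D))"
      using run stack_run_determ by (intro inj_onI) metis
    show "(\<lambda>P. block_path P k) ` NC (image_mset Suc D) = luk_paths D"
    proof (intro equalityI subsetI)
      fix s assume "s \<in> (\<lambda>P. block_path P k) ` NC (image_mset Suc D)"
      then obtain P where P: "P \<in> NC (image_mset Suc D)" "s = block_path P k" by blast
      from stack_run_block_path[OF run[OF P(1)]] P
      have "image_mset Suc (pops s) = image_mset Suc D" "luk_path s 0" by (auto simp: NC_def)
      moreover have "pops s = D"
        using arg_cong[OF calculation(1), of "image_mset (\<lambda>x. x - 1)"] by (simp add: multiset.map_comp o_def)
      ultimately show "s \<in> luk_paths D" by (simp add: luk_paths_def)
    next
      fix s assume s: "s \<in> luk_paths D"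
      then obtain P where P: "stack_run s [] P"
        using luk_path_stack_run[of s 0] by (auto simp: luk_paths_def)
      have "length s = k" using luk_paths_props(2)[OF s] by (simp add: k_def)
      then show "s \<in> (\<lambda>P. block_path P k) ` NC (image_mset Suc D)"
        using stack_run_partition[OF P] stack_run_block_path[OF P] s sum
        by (intro image_eqI[of _ _ P]) (auto simp: NC_def luk_paths_def)
    qed
  qed
  then show ?thesis by (rule bij_betw_same_card)
qed

lemma luk_path_replicate: "luk_path s h \<Longrightarrow> luk_path (replicate m 0 @ s) (m + h)"
  by (induction m) (auto intro: luk_path.up)

text \<open>Each part d is realised by d pushes followed by a pop of d. Nonemptiness makes the
  leading coefficient positive, so that a relative error makes sense.\<close>

lemma luk_paths_nonempty:
  assumes "0 \<notin># D"
  shows "luk_paths D \<noteq> {}"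
  using assms
proof (induction D)
  case empty
  show ?case using luk_path.Nil by (force simp: luk_paths_def)
next
  case (add d D)
  then obtain s where s: "luk_path s 0" "pops s = D" by (auto simp: luk_paths_def)
  obtain e where d: "d = Suc e" using add.prems by (cases d) auto
  have "luk_path (d # replicate d 0 @ s) 0"
    unfolding d using luk_path_replicate[OF s(1), of "Suc e"] by (intro luk_path.down) simp
  moreover have "pops (replicate m 0 @ s) = D" for m using s(2) by (induction m) auto
  then have "pops (d # replicate d 0 @ s) = add_mset d D" using d by simp
  ultimately show ?case by (auto simp: luk_paths_def)
qed

section \<open>Asymptotics\<close>

definition few_letter_tuples :: "nat \<Rightarrow> nat \<Rightarrow> nat \<Rightarrow> nat list set" where
  "few_letter_tuples n k e = {is. length is = k \<and> set is \<subseteq> {0..n} \<and> card (set is - {0}) \<le> e}"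

text \<open>A tuple is coded by a list L of e letters and k indices into \<open>0 # L\<close>, where
  index 0 stands for the value 0.\<close>

lemma card_few_letter_tuples:
  assumes "1 \<le> n"
  shows "card (few_letter_tuples n k e) \<le> n ^ e * Suc e ^ k"
proof -
  define A where "A = {L. set L \<subseteq> {1..n} \<and> length L = e}"
  define I where "I = {ix. set ix \<subseteq> {0..e} \<and> length ix = k}"
  have "few_letter_tuples n k e \<subseteq> (\<lambda>(L, ix). map (\<lambda>i. (0 # L) ! i) ix) ` (A \<times> I)"
  proof
    fix "is" assume i: "is \<in> few_letter_tuples n k e"
    obtain L0 where L0: "set L0 = set is - {0}" "distinct L0"
      using finite_distinct_list[of "set is - {0}"] by auto
    have len: "length L0 \<le> e"
      using i L0 distinct_card[OF L0(2)] by (simp add: few_letter_tuples_def)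
    \<comment> \<open>Padding with the letter 1, available because n is positive, brings the list to
      length exactly e.\<close>
    define L where "L = L0 @ replicate (e - length L0) 1"
    have "set L0 \<subseteq> {1..n}" using L0 i by (force simp: few_letter_tuples_def)
    then have L: "L \<in> A" using len assms by (auto simp: A_def L_def)
    have "\<exists>j. j \<le> e \<and> (0 # L) ! j = x" if "x \<in> set is" for x
    proof -
      have "x \<in> set (0 # L)" using that L0 by (auto simp: L_def)
      then obtain j where "j < length (0 # L)" "(0 # L) ! j = x" by (auto simp only: in_set_conv_nth)
      then show ?thesis using L by (intro exI[of _ j]) (simp add: A_def)
    qed
    then obtain f where f: "\<And>x. x \<in> set is \<Longrightarrow> f x \<le> e \<and> (0 # L) ! f x = x" by metis
    have "map (\<lambda>i. (0 # L) ! i) (map f is) = is"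
      unfolding map_map by (rule map_idI) (simp only: comp_def f)
    moreover have "map f is \<in> I" using f i by (auto simp: I_def few_letter_tuples_def)
    ultimately show "is \<in> (\<lambda>(L, ix). map (\<lambda>i. (0 # L) ! i) ix) ` (A \<times> I)"
      using L by (intro image_eqI[of _ _ "(L, map f is)"]) auto
  qed
  moreover have "finite (A \<times> I)"
    unfolding A_def I_def by (intro finite_cartesian_product finite_lists_length_eq) auto
  ultimately have "card (few_letter_tuples n k e) \<le> card (A \<times> I)"
    by (intro surj_card_le)
  then show ?thesis by (simp add: A_def I_def card_cartesian_product card_lists_length_eq)
qed

lemma falling_factorial_le: "real (\<Prod>i\<le>e. n - i) \<le> real n ^ Suc e"
proof -
  have "(\<Prod>i\<le>e. n - i) \<le> (\<Prod>i\<le>e. n)" by (intro prod_mono) auto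
  also have "\<dots> = n ^ Suc e" by simp
  finally show ?thesis by (metis of_nat_mono of_nat_power)
qed

lemma falling_factorial_lower_bound:
  "\<exists>K\<ge>0. \<forall>n. real n ^ Suc e - K * real n ^ e \<le> real (\<Prod>i\<le>e. n - i)"
proof (induction e)
  case 0
  show ?case by (rule exI[of _ 0]) simp
next
  case (Suc e)
  then obtain K where K: "0 \<le> K" "\<And>n. real n ^ Suc e - K * real n ^ e \<le> real (\<Prod>i\<le>e. n - i)" by blast
  \<comment> \<open>The new factor is at least n minus \<open>Suc e\<close>: multiplying by n
    carries K along, and the subtracted term costs another \<open>Suc e\<close>.\<close>
  have "real n ^ Suc (Suc e) - (K + real (Suc e)) * real n ^ Suc e \<le> real (\<Prod>i\<le>Suc e. n - i)" for n
  proof -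
    define p where "p = real (\<Prod>i\<le>e. n - i)"
    have "p \<le> real n ^ Suc e" unfolding p_def by (rule falling_factorial_le)
    then have "real (Suc e) * p \<le> real (Suc e) * real n ^ Suc e" by (intro mult_left_mono) auto
    moreover have "(real n ^ Suc e - K * real n ^ e) * real n \<le> p * real n"
      unfolding p_def using K(2) by (intro mult_right_mono) auto
    ultimately have "real n ^ Suc (Suc e) - (K + real (Suc e)) * real n ^ Suc e \<le> p * (real n - real (Suc e))"
      by (simp add: algebra_simps)
    \<comment> \<open>For n below \<open>Suc e\<close> the truncated factor is 0 and the real
      difference negative, so only an inequality holds.\<close>
    also have "\<dots> \<le> p * real (n - Suc e)"
      by (intro mult_left_mono) (simp_all add: p_def prod_nonneg)
    also have "\<dots> = real (\<Prod>i\<le>Suc e. n - i)" by (simp add: p_def)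
    finally show ?thesis .
  qed
  then show ?case using K(1) by (intro exI[of _ "K + real (Suc e)"]) auto
qed

section \<open>Tuples of a given cycle type and the coefficient\<close>

definition typed_tuples :: "nat \<Rightarrow> nat \<Rightarrow> nat multiset \<Rightarrow> nat list set" where
  "typed_tuples n k lam = {is \<in> adm_tuples n k. cyc_type n (tuple_prod is) = lam}"

lemma finite_adm_tuples: "finite (adm_tuples n k)"
proof (rule finite_subset)
  show "adm_tuples n k \<subseteq> {is. set is \<subseteq> {0..n} \<and> length is = k}" by (auto simp: adm_tuples_def)
qed (rule finite_lists_length_eq, simp)

lemma tuple_prod_permutes:
  assumes "is \<in> adm_tuples n k" "2 \<le> k"
  shows "tuple_prod is permutes {1..n}"
proof -
  note walk = adm_tuple_walk[OF assms]
  have "hd is \<in> set is" using walk(1) by simp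
  then have "set (hd is # rev is) - {0} \<subseteq> {1..n}" using walk(4) by fastforce
  then show ?thesis
    using wprod_permutes[of "hd is # rev is"] tuple_prod_eq_wprod[OF walk(1)] permutes_subset by metis
qed

lemma Ncoef_Dk:
  assumes "2 \<le> k"
  shows "Ncoef lam (Dk n k) n = of_nat (card (typed_tuples n k lam)) / of_nat (n + 1)"
proof -
  define S where "S = {\<sigma>. \<sigma> permutes {1..n} \<and> cyc_type n \<sigma> = lam}"
  have S: "finite S"
    unfolding S_def by (rule finite_subset[OF _ finite_permutations[of "{1..n}"]]) auto
  have "typed_tuples n k lam = (\<Union>\<sigma>\<in>S. {is \<in> adm_tuples n k. tuple_prod is = \<sigma>})"
    using tuple_prod_permutes[OF _ assms] by (auto simp: typed_tuples_def S_def)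
  also have "card \<dots> = (\<Sum>\<sigma>\<in>S. card {is \<in> adm_tuples n k. tuple_prod is = \<sigma>})"
    using S finite_adm_tuples by (intro card_UN_disjoint) auto
  finally show ?thesis
    by (simp add: Ncoef_def Dk_def S_def sum_divide_distrib)
qed

lemma planar_tuples_subset:
  assumes "0 < size D"
  shows "planar_tuples n D \<subseteq> typed_tuples n (sum_mset D + size D) (filter_mset (\<lambda>m. 2 \<le> m) D)"
proof
  fix "is" assume "is \<in> planar_tuples n D"
  then obtain s where s: "set is \<subseteq> {1..n}" "planar_walk (hd is # rev is) [hd is] s" "pops s = D"
    by (auto simp: planar_tuples_def)
  define k where "k = sum_mset D + size D"
  note b = planar_walk_basic[OF s(2)]
  have last: "last (hd is # rev is) = hd (hd is # rev is)" using b by (metis last_ConsL list.sel(1))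
  have len: "length is = k" using closed_planar_walk_pops[OF s(2) last] b s(3) by (simp add: k_def)
  then have ne: "is \<noteq> []" using assms by (auto simp: k_def)
  have "distinct_adj (rev (is @ [hd is]))" using b by simp
  then have "distinct_adj (is @ [hd is])" by (simp only: distinct_adj_rev)
  then have "distinct_adj is" "last is \<noteq> hd is" using ne by (auto simp: distinct_adj_append_iff)
  then have "is \<in> adm_tuples n k"
    using s(1) len ne by (fastforce simp: adm_tuples_def distinct_adj_conv_nth last_conv_nth hd_conv_nth)
  then show "is \<in> typed_tuples n (sum_mset D + size D) (filter_mset (\<lambda>m. 2 \<le> m) D)"
    using planar_tuple_cyc_type[OF ne s(1,2)] s(3) by (simp add: typed_tuples_def k_def)
qed

text \<open>In the planar case the type and k determine the pops to be D. Otherwise at most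
  \<open>sum_mset D\<close> letters occur, one fewer than in a planar tuple for D.\<close>

lemma typed_tuples_subset:
  assumes D: "0 \<notin># D" "sum_mset D + size D = k" "2 \<le> k"
  shows "typed_tuples n k (filter_mset (\<lambda>m. 2 \<le> m) D) \<subseteq> planar_tuples n D \<union> few_letter_tuples n k (sum_mset D)"
proof
  define lam where "lam = filter_mset (\<lambda>m. 2 \<le> m) D"
  fix "is" assume "is \<in> typed_tuples n k (filter_mset (\<lambda>m. 2 \<le> m) D)"
  then have i: "is \<in> adm_tuples n k" "cyc_type n (tuple_prod is) = lam"
    by (auto simp: typed_tuples_def lam_def)
  note walk = adm_tuple_walk[OF i(1) D(3)]
  from adm_tuple_dichotomy[OF i(1) D(3)]
  show "is \<in> planar_tuples n D \<union> few_letter_tuples n k (sum_mset D)"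
  proof (elim disjE exE conjE)
    fix s assume s: "planar_walk (hd is # rev is) [hd is] s"
      "cyc_type n (tuple_prod is) = filter_mset (\<lambda>m. 2 \<le> m) (pops s)"
    note b = planar_walk_basic[OF s(1)]
    have "sum_mset (pops s) + size (pops s) = k"
      using closed_planar_walk_pops[OF s(1)] walk b by simp
    then have "pops s = D"
      using filter_ge2_determines[OF zero_notin_pops[of s] D(1)] D(2) s(2) i(2) by (simp add: lam_def)
    moreover have "set is \<subseteq> {1..n}"
    proof
      fix x assume x: "x \<in> set is"
      then have "x \<noteq> 0" using b by (metis list.set_intros(2) set_rev)
      then show "x \<in> {1..n}" using x walk(4) by auto
    qed
    ultimately show ?thesis using s(1) by (auto simp: planar_tuples_def)
  next
    assume "2 * card (set is - {0}) + size (cyc_type n (tuple_prod is)) \<le> k + sum_mset (cyc_type n (tuple_prod is))"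
    then have "card (set is - {0}) \<le> sum_mset D"
      using filter_ge2_sum_size[OF D(1) lam_def] D(2) i(2) by simp
    then show ?thesis using walk by (simp add: few_letter_tuples_def)
  qed
qed

text \<open>The planar tuples give the leading term and the others are of lower order. Comparing
  with a multiple of \<open>n + 1\<close> anticipates the normalisation in
  \<open>Dk\<close>.\<close>

lemma card_typed_tuples_bound:
  assumes D: "0 \<notin># D" "sum_mset D + size D = k" "2 \<le> k"
  shows "\<exists>B. \<forall>n\<ge>1. \<bar>real (card (typed_tuples n k (filter_mset (\<lambda>m. 2 \<le> m) D)))
      - real (card (luk_paths D)) * (real (n + 1) * real n ^ sum_mset D)\<bar> \<le> B * real n ^ sum_mset D"
proof -
  define e where "e = sum_mset D"
  define c where "c = real (card (luk_paths D))"
  obtain K where K: "0 \<le> K" "\<And>n. real n ^ Suc e - K * real n ^ e \<le> real (\<Prod>i\<le>e. n - i)"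
    using falling_factorial_lower_bound by blast
  define C where "C = real (Suc e ^ k)"
  have D_pos: "0 < size D" using D(2,3) by (cases "D = {#}") (auto simp: nonempty_has_size)
  have c: "0 \<le> c" by (simp add: c_def)
  \<comment> \<open>The three constants account for tuples with few letters, for the falling
    factorial, and for replacing n by \<open>n + 1\<close>.\<close>
  have "\<bar>real (card (typed_tuples n k (filter_mset (\<lambda>m. 2 \<le> m) D))) - c * (real (n + 1) * real n ^ e)\<bar>
      \<le> (C + c * K + c) * real n ^ e" if n: "1 \<le> n" for n
  proof -
    define t where "t = real (card (typed_tuples n k (filter_mset (\<lambda>m. 2 \<le> m) D)))"
    define p where "p = real (\<Prod>i\<le>e. n - i)"
    define r where "r = real n ^ e"
    have fin: "finite (typed_tuples n k (filter_mset (\<lambda>m. 2 \<le> m) D))"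
      using finite_adm_tuples by (auto simp: typed_tuples_def)
    have planar: "real (card (planar_tuples n D)) = c * p"
      using card_planar_tuples[OF D_pos] by (simp add: c_def p_def e_def)
    have finf: "finite (few_letter_tuples n k e)"
      by (rule finite_subset[OF _ finite_lists_length_eq[of "{0..n}" k]])
        (auto simp: few_letter_tuples_def)
    have sub: "planar_tuples n D \<subseteq> typed_tuples n k (filter_mset (\<lambda>m. 2 \<le> m) D)"
      using planar_tuples_subset[OF D_pos] D(2) by simp
    have lower: "c * p \<le> t"
      unfolding t_def planar[symmetric] using card_mono[OF fin sub] by simp
    have "card (typed_tuples n k (filter_mset (\<lambda>m. 2 \<le> m) D)) \<le> card (planar_tuples n D \<union> few_letter_tuples n k e)"
      using typed_tuples_subset[OF D] finite_subset[OF sub fin] finf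
      by (intro card_mono) (auto simp: e_def)
    also have "\<dots> \<le> card (planar_tuples n D) + card (few_letter_tuples n k e)" by (rule card_Un_le)
    also have "\<dots> \<le> card (planar_tuples n D) + n ^ e * Suc e ^ k"
      using card_few_letter_tuples[OF n] by simp
    finally have "t \<le> real (card (planar_tuples n D) + n ^ e * Suc e ^ k)"
      unfolding t_def by (rule of_nat_mono)
    then have upper: "t \<le> c * p + C * r" unfolding planar[symmetric] by (simp add: C_def r_def mult.commute)
    have "p \<le> real n * r" using falling_factorial_le[of n e] by (simp add: p_def r_def)
    then have 1: "c * p \<le> c * (real n * r)" using c by (rule mult_left_mono)
    have "real n * r - K * r \<le> p" using K(2)[of n] by (simp add: p_def r_def)
    then have 2: "c * (real n * r - K * r) \<le> c * p" using c by (rule mult_left_mono)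
    have "0 \<le> r" "0 \<le> C" by (simp_all add: r_def C_def)
    then have 3: "0 \<le> c * r" "0 \<le> C * r" "0 \<le> c * (K * r)" using c K(1) by simp_all
    have "c * (real (n + 1) * r) = c * (real n * r) + c * r" by (simp add: algebra_simps)
    moreover have "c * (real n * r - K * r) = c * (real n * r) - c * (K * r)" by (simp add: algebra_simps)
    moreover have "(C + c * K + c) * r = C * r + c * (K * r) + c * r" by (simp add: algebra_simps)
    ultimately show ?thesis
      using lower upper 1 2 3 unfolding t_def[symmetric] r_def[symmetric] by linarith
  qed
  then show ?thesis unfolding c_def e_def by blast
qed

lemma Ncoef_asymptotics:
  assumes "2 \<le> k" "\<mu> \<in> Ybar k"
  shows "\<exists>h :: nat \<Rightarrow> complex. h \<in> O(\<lambda>n. of_real (1 / real n)) \<and>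
    (\<forall>\<^sub>F n in at_top. Ncoef (Rem \<mu>) (Dk n k) n =
       of_nat (card (NC \<mu>)) * of_real (real n powr ((real (lfun (Rem \<mu>)) + real k) / 2)) * (1 + h n))"
proof -
  obtain D where D: "\<mu> = image_mset Suc D" "0 \<notin># D" "sum_mset D + size D = k"
    using Ybar_image_Suc[OF assms(2)] .
  define lam where "lam = filter_mset (\<lambda>m. 2 \<le> m) D"
  define e where "e = sum_mset D"
  define c where "c = real (card (NC \<mu>))"
  have Rem: "Rem \<mu> = lam" using Rem_image_Suc[OF D(2)] D(1) by (simp add: lam_def)
  have card: "card (NC \<mu>) = card (luk_paths D)" using card_NC_eq_card_luk_paths[OF D(2)] D(1) by simp
  then have c: "1 \<le> c"
    using luk_paths_nonempty[OF D(2)] finite_luk_paths[of D] by (simp add: c_def card_gt_0_iff Suc_le_eq)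
  \<comment> \<open>Ones cancel in the sum minus the size, so \<open>lfun lam\<close> is
    \<open>sum_mset D - size D\<close>; adding k, their sum, gives 2e.\<close>
  have exponent: "(real (lfun (Rem \<mu>)) + real k) / 2 = real e"
  proof -
    \<comment> \<open>This makes the natural number subtraction in \<open>lfun\<close> a genuine
      one.\<close>
    have "size lam \<le> sum_mset lam"
    proof -
      have "size M \<le> sum_mset M" if "\<forall>x\<in>#M. 2 \<le> x" for M :: "nat multiset"
        using that by (induction M) auto
      then show ?thesis by (simp add: lam_def)
    qed
    then have "lfun (Rem \<mu>) + k = 2 * e"
      using filter_ge2_sum_size[OF D(2) lam_def] D(3) by (simp add: Rem lfun_def e_def)
    then have "real (lfun (Rem \<mu>) + k) = real (2 * e)" by (rule arg_cong)
    then show ?thesis unfolding of_nat_add of_nat_mult by simp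
  qed
  obtain B where B: "\<And>n. 1 \<le> n \<Longrightarrow>
      \<bar>real (card (typed_tuples n k lam)) - c * (real (n + 1) * real n ^ e)\<bar> \<le> B * real n ^ e"
    using card_typed_tuples_bound[OF D(2,3) assms(1)] card unfolding c_def lam_def e_def by auto
  \<comment> \<open>X is the relative error of the tuple count against its leading term; it is real,
    and h is its complex copy.\<close>
  define X where "X n = real (card (typed_tuples n k lam)) / (c * (real (n + 1) * real n ^ e)) - 1" for n
  define h where "h n = complex_of_real (X n)" for n
  have X: "\<bar>X n\<bar> \<le> B * \<bar>1 / real n\<bar>" if n: "1 \<le> n" for n
  proof -
    define q where "q = c * (real (n + 1) * real n ^ e)"
    have pos: "0 < real n ^ e" using n by simp
    then have q: "0 < q" using c by (simp add: q_def)
    have B0: "0 \<le> B * real n ^ e" using B[OF n] by linarith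
    have "real n * real n ^ e \<le> real (n + 1) * real n ^ e" by (intro mult_right_mono) auto
    also have "\<dots> \<le> q" using c pos by (simp add: q_def)
    finally have nq: "real n * real n ^ e \<le> q" .
    have "X n = (real (card (typed_tuples n k lam)) - q) / q"
      unfolding X_def q_def[symmetric] diff_divide_distrib using q by simp
    then have "\<bar>X n\<bar> = \<bar>real (card (typed_tuples n k lam)) - q\<bar> / q" using q by simp
    also have "\<dots> \<le> B * real n ^ e / q"
      using B[OF n] q by (intro divide_right_mono) (auto simp: q_def)
    also have "\<dots> \<le> B * real n ^ e / (real n * real n ^ e)"
      using nq n pos q B0 by (intro divide_left_mono mult_pos_pos) auto
    also have "\<dots> = B * \<bar>1 / real n\<bar>" using pos by simp
    finally show ?thesis .
  qed
  have "h \<in> O(\<lambda>n. of_real (1 / real n))"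
  proof (rule bigoI)
    show "\<forall>\<^sub>F n in at_top. norm (h n) \<le> B * norm (complex_of_real (1 / real n))"
      using eventually_ge_at_top[of 1] by eventually_elim (use X in \<open>simp only: h_def norm_of_real\<close>)
  qed
  moreover have "Ncoef (Rem \<mu>) (Dk n k) n =
      of_nat (card (NC \<mu>)) * of_real (real n powr ((real (lfun (Rem \<mu>)) + real k) / 2)) * (1 + h n)"
    if "1 \<le> n" for n
  proof -
    have pw: "real n powr real e = real n ^ e" using that by (simp add: powr_realpow)
    have "c * real n ^ e * (1 + X n) = real (card (typed_tuples n k lam)) / real (n + 1)"
    proof -
      have "a * r * (1 + (t / (a * (m * r)) - 1)) = t / m" if "a \<noteq> 0" "r \<noteq> 0" "m \<noteq> 0" for a r m t :: real
        using that by (simp add: field_simps)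
      then show ?thesis unfolding X_def using that c by simp
    qed
    then have "complex_of_real (c * real n ^ e * (1 + X n))
        = complex_of_real (real (card (typed_tuples n k lam)) / real (n + 1))" by (rule arg_cong)
    then show ?thesis
      unfolding exponent unfolding pw Rem Ncoef_Dk[OF assms(1)] h_def by (simp add: c_def)
  qed
  then have "\<forall>\<^sub>F n in at_top. Ncoef (Rem \<mu>) (Dk n k) n =
      of_nat (card (NC \<mu>)) * of_real (real n powr ((real (lfun (Rem \<mu>)) + real k) / 2)) * (1 + h n)"
    using eventually_ge_at_top[of 1] by (rule eventually_mono[rotated])
  ultimately show ?thesis by blast
qed

theorem mainTheorem5:
  shows "(\<forall>n k lam. 1 \<le> n \<longrightarrow> 2 \<le> k \<longrightarrow> parts_ge2 lam \<longrightarrow>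
            Ncoef lam (Dk n k) n \<noteq> 0 \<longrightarrow> (\<exists>\<mu>\<in>Ybar k. lam = Rem \<mu>))
       \<and> (\<forall>k \<mu>. 2 \<le> k \<longrightarrow> \<mu> \<in> Ybar k \<longrightarrow>
            (\<exists>h :: nat \<Rightarrow> complex. h \<in> O(\<lambda>n. of_real (1 / real n)) \<and>
               (\<forall>\<^sub>F n in at_top. Ncoef (Rem \<mu>) (Dk n k) n =
                  of_nat (card (NC \<mu>)) * of_real (real n powr ((real (lfun (Rem \<mu>)) + real k) / 2))
                  * (1 + h n))))"
proof (intro conjI allI impI)
  fix n k :: nat and lam
  assume k: "2 \<le> k" and lam: "parts_ge2 lam" and "Ncoef lam (Dk n k) n \<noteq> 0"
  then have "typed_tuples n k lam \<noteq> {}" by (auto simp: Ncoef_Dk)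
  then show "\<exists>\<mu>\<in>Ybar k. lam = Rem \<mu>"
    using cyc_type_adm_tuple_Rem[OF _ k lam] by (auto simp: typed_tuples_def)
qed (rule Ncoef_asymptotics)

end
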